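(* Suppose that the ABIP algorithm described in the context is terminated when $\mu^k<\varepsilon$, where $\varepsilon>0$ is a pre-given tolerance. Let $T_{\mathrm{IPM}}$ be the total number of outer (interior-point) iterations and $T_{\mathrm{ADMM}}$ the total number of inner (ADMM) iterations over all outer iterations. Then $$T_{\mathrm{IPM}}=O\left(\log\left(\frac1\varepsilon\right)\right),\qquad T_{\mathrm{ADMM}}=O\left(\frac{\kappa_A^2\|Q\|^2}{\varepsilon}\log\left(\frac1\varepsilon\right)\right),$$ where $\kappa_A:=\lambda_{\max}(A^\top A)/\lambda_{\min}(AA^\top)$.
   Context: Data: $A\in\mathbb R^{m\times n}$ with $m\le n$ and full row rank, $b\in\mathbb R^m$, $c\in\mathbb R^n$; $\mathbf e\in\mathbb R^n$ is the all-ones vector; $\circ$ is the entrywise product; $\|\cdot\|$ is the Euclidean norm for vectors and the spectral norm for matrices; $\lambda_{\max},\lambda_{\min}$ are the largest and smallest eigenvalues. Put $\bar b=b-A\mathbf e$, $\bar c=c-\mathbf e$, $\bar z=c^\top\mathbf e+1$ and $$Q=\begin{bmatrix} 0 & A & -b & \bar b \\ -A^\top & 0 & c & -\bar c \\ b^\top & -c^\top & 0 & \bar z \\ -\bar b^\top & \bar c^\top & -\bar z & 0 \end{bmatrix},\quad u=\begin{bmatrix} y \\ x \\ \tau \\ \theta \end{bmatrix},\quad v=\begin{bmatrix} r \\ s \\ \kappa \\ \xi \end{bmatrix},$$ with $y,r\in\mathbb R^m$, $x,s\in\mathbb R^n$, $\tau,\theta,\kappa,\xi\in\mathbb R$. (These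 come from the homogeneous self-dual embedding of the LP $\min\{c^\top x: Ax=b,x\ge0\}$ and its dual.) ABIP algorithm. Parameters: $\mu^0=\beta>0$, $\gamma\in(0,1)$, $\mu^{k+1}=\gamma\mu^k$. Initial point: $r_0^0=y_0^0=0$, $x_0^0=s_0^0=\mathbf e$, $\tau_0^0=\kappa_0^0=\theta_0^0=1$, $\xi_0^0=-n-1$. Inner (ADMM) recursion in outer iteration $k$, for $i=0,1,2,\dots$ (scalar/vector operations entrywise): $$\tilde u_{i+1}^k=(I+Q)^{-1}(u_i^k+v_i^k),\qquad y_{i+1}^k=\tilde y_{i+1}^k,\qquad \theta_{i+1}^k=\tilde\theta_{i+1}^k,$$ $$x_{i+1}^k=\tfrac12\Big[(\tilde x_{i+1}^k-s_i^k)+\sqrt{(\tilde x_{i+1}^k-s_i^k)\circ(\tilde x_{i+1}^k-s_i^k)+\tfrac{4\mu^k}{\beta}}\Big],$$ $$\tau_{i+1}^k=\tfrac12\Big[(\tilde\tau_{i+1}^k-\kappa_i^k)+\sqrt{(\tilde\tau_{i+1}^k-\kappa_i^k)^2+\tfrac{4\mu^k}{\beta}}\Big],\qquad v_{i+1}^k=v_i^k-\tilde u_{i+1}^k+u_{i+1}^k .$$ The inner loop is stopped at the first index $i=N_k$ for which $\|Qu_i^k-v_i^k\|^2\le\mu^k$; $N_k$ is the number of ADMM iterations in outer iteration $k$. The next outer iteration starts from $r_0^{k+1}=0$, $\xi_0^{k+1}=-n-1$ and $$(y_0^{k+1},x_0^{k+1},s_0^{k+1},\tau_0^{k+1},\kappa_0^{k+1},\theta_0^{k+1})=\sqrt\gamma\,(y_{N_k}^k,x_{N_k}^k,s_{N_k}^k,\tau_{N_k}^k,\kappa_{N_k}^k,\theta_{N_k}^k).$$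 $T_{\mathrm{ADMM}}$ is the sum of $N_k$ over the outer iterations performed. The $O$-notation is as $\varepsilon\downarrow0$; the implied constants do not depend on $\varepsilon$ (they may depend on the parameters $\beta,\gamma$ and on the problem instance $A,b,c$, in particular through uniform bounds on the iterates). *)

theory Defs
  imports "HOL-Analysis.Analysis" "HOL-Library.Landau_Symbols"
begin

text \<open>Index type of the blocks \<open>(y, x, \<tau>, \<theta>)\<close> of \<open>u\<close>, equally of the blocks
  \<open>(r, s, \<kappa>, \<xi>)\<close> of \<open>v\<close>, so that \<open>u\<close> and \<open>v\<close> are vectors in
  \<open>\<real>\<^sup>m\<^sup>+\<^sup>n\<^sup>+\<^sup>2\<close> and \<open>Q\<close> is a square matrix of that size.\<close>

datatype ('m, 'n) blk = BY 'm | BX 'n | BTau | BTheta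

lemma UNIV_blk: "UNIV = range BY \<union> range BX \<union> {BTau, BTheta}"
proof (rule UNIV_eq_I)
  fix p :: "('a, 'b) blk"
  show "p \<in> range BY \<union> range BX \<union> {BTau, BTheta}"
    by (cases p) auto
qed

instance blk :: (finite, finite) finite
  by standard (simp add: UNIV_blk)

definition b_bar :: "real^'n^'m \<Rightarrow> real^'m \<Rightarrow> real^'m"
  where "b_bar A b = b - A *v 1"

definition c_bar :: "real^'n \<Rightarrow> real^'n"
  where "c_bar c = c - 1"

definition z_bar :: "real^'n \<Rightarrow> real"
  where "z_bar c = c \<bullet> 1 + 1"

fun Q_entry :: "real^'n^'m \<Rightarrow> real^'m \<Rightarrow> real^'n \<Rightarrow> ('m, 'n) blk \<Rightarrow> ('m, 'n) blk \<Rightarrow> real"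
where
  "Q_entry A b c (BY i) (BY i') = 0"
| "Q_entry A b c (BY i) (BX j) = A $ i $ j"
| "Q_entry A b c (BY i) BTau = - (b $ i)"
| "Q_entry A b c (BY i) BTheta = b_bar A b $ i"
| "Q_entry A b c (BX j) (BY i) = - (A $ i $ j)"
| "Q_entry A b c (BX j) (BX j') = 0"
| "Q_entry A b c (BX j) BTau = c $ j"
| "Q_entry A b c (BX j) BTheta = - (c_bar c $ j)"
| "Q_entry A b c BTau (BY i) = b $ i"
| "Q_entry A b c BTau (BX j) = - (c $ j)"
| "Q_entry A b c BTau BTau = 0"
| "Q_entry A b c BTau BTheta = z_bar c"
| "Q_entry A b c BTheta (BY i) = - (b_bar A b $ i)"
| "Q_entry A b c BTheta (BX j) = c_bar c $ j"
| "Q_entry A b c BTheta BTau = - z_bar c"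
| "Q_entry A b c BTheta BTheta = 0"

definition Q_mat :: "real^'n^'m \<Rightarrow> real^'m \<Rightarrow> real^'n \<Rightarrow> real^('m, 'n) blk^('m, 'n) blk"
  where "Q_mat A b c = (\<chi> p q. Q_entry A b c p q)"

definition spectral_norm :: "real^'a^'b \<Rightarrow> real"
  where "spectral_norm M = onorm ((*v) M)"

definition eigenvalues :: "real^'a^'a \<Rightarrow> real set"
  where "eigenvalues M = {l. \<exists>w. w \<noteq> 0 \<and> M *v w = l *\<^sub>R w}"

text \<open>Only applied to symmetric matrices, whose spectrum is real, finite and nonempty.\<close>

definition lambda_max :: "real^'a^'a \<Rightarrow> real"
  where "lambda_max M = Max (eigenvalues M)"

definition lambda_min :: "real^'a^'a \<Rightarrow> real"
  where "lambda_min M = Min (eigenvalues M)"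

definition kappa_A :: "real^'n^'m \<Rightarrow> real"
  where "kappa_A A = lambda_max (transpose A ** A) / lambda_min (A ** transpose A)"

primrec mu :: "real \<Rightarrow> real \<Rightarrow> nat \<Rightarrow> real"
where
  "mu \<beta> \<gamma> 0 = \<beta>"
| "mu \<beta> \<gamma> (Suc k) = \<gamma> * mu \<beta> \<gamma> k"

text \<open>A state is the pair \<open>(u, v)\<close>.\<close>

type_synonym ('m, 'n) state = "(real^('m, 'n) blk) \<times> (real^('m, 'n) blk)"

definition barrier_update :: "real \<Rightarrow> real \<Rightarrow> real \<Rightarrow> real"
  where "barrier_update \<mu> \<beta> d = (d + sqrt (d * d + 4 * \<mu> / \<beta>)) / 2"

definition admm_step ::
  "real^'n^'m \<Rightarrow> real^'m \<Rightarrow> real^'n \<Rightarrow> real \<Rightarrow> real \<Rightarrow> ('m, 'n) state \<Rightarrow> ('m, 'n) state"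
where
  "admm_step A b c \<beta> \<mu> = (\<lambda>(u, v).
     let ut = matrix_inv (mat 1 + Q_mat A b c) *v (u + v);
         u' = (\<chi> p. case p of
                 BY i \<Rightarrow> ut $ BY i
               | BX j \<Rightarrow> barrier_update \<mu> \<beta> (ut $ BX j - v $ BX j)
               | BTau \<Rightarrow> barrier_update \<mu> \<beta> (ut $ BTau - v $ BTau)
               | BTheta \<Rightarrow> ut $ BTheta)
     in (u', v - ut + u'))"

definition inner_stop ::
  "real^'n^'m \<Rightarrow> real^'m \<Rightarrow> real^'n \<Rightarrow> real \<Rightarrow> ('m, 'n) state \<Rightarrow> bool"
where
  "inner_stop A b c \<mu> = (\<lambda>(u, v). (norm (Q_mat A b c *v u - v))\<^sup>2 \<le> \<mu>)"

text \<open>Number of steps from the state \<open>z\<close> to the first one passing the stopping test, the test being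
  applied to \<open>z\<close> itself as well. \<open>LEAST\<close> is unspecified if no iterate passes it, so a bound on
  this number is meaningful only together with termination of the inner loop.\<close>

definition inner_count ::
  "real^'n^'m \<Rightarrow> real^'m \<Rightarrow> real^'n \<Rightarrow> real \<Rightarrow> real \<Rightarrow> ('m, 'n) state \<Rightarrow> nat"
where
  "inner_count A b c \<beta> \<mu> z = (LEAST i. inner_stop A b c \<mu> ((admm_step A b c \<beta> \<mu> ^^ i) z))"

definition initial_state :: "('m::finite, 'n::finite) state"
where
  "initial_state =
    ((\<chi> p. case p of BY i \<Rightarrow> 0 | BX j \<Rightarrow> 1 | BTau \<Rightarrow> 1 | BTheta \<Rightarrow> 1),
     (\<chi> p. case p of BY i \<Rightarrow> 0 | BX j \<Rightarrow> 1 | BTau \<Rightarrow> 1 | BTheta \<Rightarrow> - real CARD('n) - 1))"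

definition restart :: "real \<Rightarrow> ('m::finite, 'n::finite) state \<Rightarrow> ('m, 'n) state"
where
  "restart \<gamma> = (\<lambda>(u, v).
    (sqrt \<gamma> *\<^sub>R u,
     (\<chi> p. case p of
         BY i \<Rightarrow> 0
       | BX j \<Rightarrow> sqrt \<gamma> * v $ BX j
       | BTau \<Rightarrow> sqrt \<gamma> * v $ BTau
       | BTheta \<Rightarrow> - real CARD('n) - 1)))"

primrec outer_start ::
  "real^'n^'m \<Rightarrow> real^'m \<Rightarrow> real^'n \<Rightarrow> real \<Rightarrow> real \<Rightarrow> nat \<Rightarrow> ('m, 'n) state"
where
  "outer_start A b c \<beta> \<gamma> 0 = initial_state"
| "outer_start A b c \<beta> \<gamma> (Suc k) =
     (let \<mu> = mu \<beta> \<gamma> k; z = outer_start A b c \<beta> \<gamma> k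
      in restart \<gamma> ((admm_step A b c \<beta> \<mu> ^^ inner_count A b c \<beta> \<mu> z) z))"

text \<open>The state \<open>(u\<^sub>i\<^sup>k, v\<^sub>i\<^sup>k)\<close>.\<close>

definition iterate ::
  "real^'n^'m \<Rightarrow> real^'m \<Rightarrow> real^'n \<Rightarrow> real \<Rightarrow> real \<Rightarrow> nat \<Rightarrow> nat \<Rightarrow> ('m, 'n) state"
where
  "iterate A b c \<beta> \<gamma> k i =
     (admm_step A b c \<beta> (mu \<beta> \<gamma> k) ^^ i) (outer_start A b c \<beta> \<gamma> k)"

definition N_inner ::
  "real^'n^'m \<Rightarrow> real^'m \<Rightarrow> real^'n \<Rightarrow> real \<Rightarrow> real \<Rightarrow> nat \<Rightarrow> nat"
where
  "N_inner A b c \<beta> \<gamma> k = inner_count A b c \<beta> (mu \<beta> \<gamma> k) (outer_start A b c \<beta> \<gamma> k)"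

text \<open>The outer iterations performed are those with index \<open>0, \<dots>, K\<close>, where \<open>K\<close> is the first
  index with \<open>\<mu>\<^sup>K < \<epsilon>\<close>: the test is made after the inner loop of an outer iteration. Making it
  before the inner loop would drop iteration \<open>K\<close> and could only decrease both counts.\<close>

definition T_IPM :: "real \<Rightarrow> real \<Rightarrow> real \<Rightarrow> nat"
  where "T_IPM \<beta> \<gamma> \<epsilon> = Suc (LEAST k. mu \<beta> \<gamma> k < \<epsilon>)"

definition T_ADMM ::
  "real^'n^'m \<Rightarrow> real^'m \<Rightarrow> real^'n \<Rightarrow> real \<Rightarrow> real \<Rightarrow> real \<Rightarrow> nat"
  where "T_ADMM A b c \<beta> \<gamma> \<epsilon> = (\<Sum>k<T_IPM \<beta> \<gamma> \<epsilon>. N_inner A b c \<beta> \<gamma> k)"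

end

theory Submission
  imports Defs
begin

text \<open>
  The rate rests on one potential function, the distance to the central path. For the barrier
  parameter \<open>\<nu> = \<mu>/\<beta>\<close> let \<open>w\<close> be the central point: \<open>Q w\<close> takes the prescribed values on the
  \<open>y\<close> and \<open>\<theta>\<close> blocks, and \<open>w\<^sub>p (Q w)\<^sub>p = \<nu>\<close> on the \<open>x\<close> and \<open>\<tau>\<close> blocks. The pair \<open>(w, Q w)\<close> is a
  fixed point of the ADMM step. Each step consists of the resolvent of the skew matrix \<open>Q\<close> and a
  barrier update that puts the iterate back on the curve \<open>u\<^sub>p v\<^sub>p = \<nu>\<close>, along which \<open>v\<close> is
  antitone in \<open>u\<close>. These two facts give (\<open>step_dist_central\<close>)
  \<open>|(u', v') - (w, Q w)|\<^sup>2 \<le> |(u, v) - (w, Q w)|\<^sup>2 - |u - t|\<^sup>2\<close>, where \<open>t\<close> is the output of the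
  resolvent. The residual is \<open>Q u - v = (I + Q)(u - t)\<close>, so its square is at most
  \<open>(1 + \<parallel>Q\<parallel>\<^sup>2) |u - t|\<^sup>2\<close>. Summing over the steps that fail the stopping test,
  \<open>N\<^sub>k \<mu>\<^sup>k \<le> (1 + \<parallel>Q\<parallel>\<^sup>2) D\<^sub>k\<^sup>2\<close> with \<open>D\<^sub>k\<close> the distance from the start of outer iteration \<open>k\<close> to
  its central point (\<open>number_of_large_residuals\<close>).

  The distances \<open>D\<^sub>k\<close> are bounded (\<open>outer_starts_near_central\<close>): an inner loop does not increase
  the distance, the restart is a contraction with factor \<open>\<surd>\<gamma>\<close>, and the central points for
  \<open>\<nu> \<le> 1\<close> form a bounded set, whence \<open>D\<^sub>k\<^sub>+\<^sub>1 \<le> \<surd>\<gamma> D\<^sub>k + 2 C\<close>. Existence and boundedness of the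
  central points is the part where the problem data enter. For strictly feasible points
  skew-symmetry turns \<open>(u - u\<^sub>0) \<bullet> Q (u - u\<^sub>0) = 0\<close> into an identity that bounds \<open>u\<close> and \<open>Q u\<close> by
  the sum of the products \<open>u\<^sub>p (Q u)\<^sub>p\<close>; hence the potential \<open>\<Sum> (x\<^sub>p - \<nu> ln x\<^sub>p)\<close> of these products
  \<open>x\<^sub>p\<close> has a minimiser, and its derivative along the Newton direction vanishes only at a central
  point (\<open>central_exists\<close>). The known strictly feasible point is the initial state of the
  algorithm, which is exactly central for \<open>\<nu> = 1\<close>, and full row rank of \<open>A\<close> makes \<open>Q\<close>
  nondegenerate.

  The outer loop ends at the first \<open>k\<close> with \<open>\<beta> \<gamma>\<^sup>k < \<epsilon>\<close>, so it makes \<open>O(log (1/\<epsilon>))\<close> iterations, and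
  \<open>\<mu>\<^sup>k \<ge> \<gamma> \<epsilon>\<close> in each of them bounds every \<open>N\<^sub>k\<close> by a multiple of \<open>1/\<epsilon>\<close>. The factor
  \<open>\<kappa>\<^sub>A\<^sup>2 \<parallel>Q\<parallel>\<^sup>2\<close> is a constant in \<open>\<epsilon>\<close>; it can be inserted because it is positive.
\<close>

section \<open>Skew-symmetric barrier systems\<close>

lemma inner_skew_matrix:
  fixes Q :: "real^'p^'p"
  assumes "transpose Q = - Q"
  shows "x \<bullet> (Q *v y) = - ((Q *v x) \<bullet> y)"
proof -
  have neg: "(- Q) *v x = - (Q *v x)"
    by (simp add: vec_eq_iff matrix_vector_mult_def sum_negf)
  have "x \<bullet> (Q *v y) = (transpose Q *v x) \<bullet> y"
    by (simp add: dot_lmul_matrix)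
  then show ?thesis
    by (simp only: assms neg inner_minus_left)
qed

text \<open>
  The features of the embedding that the convergence proof uses. \<open>P\<close> is the set of coordinates
  subject to the barrier; outside \<open>P\<close> the variable \<open>u\<close> is free and \<open>Q u\<close> is prescribed to agree
  with \<open>Q u0\<close>. Nondegeneracy excludes a line in the free variables along which \<open>Q u\<close> stays
  constant; without it neither the feasible points of bounded complementarity nor the
  central points would be bounded.
\<close>

locale skew_barrier =
  fixes Q :: "real^'p::finite^'p" and P :: "'p set" and u0 :: "real^'p"
  assumes transpose_Q: "transpose Q = - Q"
    and u0_pos: "p \<in> P \<Longrightarrow> u0 $ p > 0"
    and Qu0_pos: "p \<in> P \<Longrightarrow> (Q *v u0) $ p > 0"
    and nondegenerate: "\<lbrakk>\<And>p. p \<in> P \<Longrightarrow> d $ p = 0; Q *v d = 0\<rbrakk> \<Longrightarrow> d = 0"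
begin

definition feasible :: "real^'p \<Rightarrow> bool"
  where "feasible u \<longleftrightarrow> (\<forall>p\<in>P. u $ p > 0 \<and> (Q *v u) $ p > 0) \<and>
    (\<forall>p. p \<notin> P \<longrightarrow> (Q *v u) $ p = (Q *v u0) $ p)"

definition central :: "real \<Rightarrow> real^'p \<Rightarrow> bool"
  where "central \<nu> u \<longleftrightarrow> feasible u \<and> (\<forall>p\<in>P. u $ p * (Q *v u) $ p = \<nu>)"

lemma feasible_u0: "feasible u0"
  by (simp add: feasible_def u0_pos Qu0_pos)

lemma skew_self: "x \<bullet> (Q *v x) = 0"
  using inner_skew_matrix[OF transpose_Q, of x x] by (simp add: inner_commute)

lemma inner_eq_sum_cone:
  assumes "\<And>p. p \<notin> P \<Longrightarrow> y $ p = 0"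
  shows "x \<bullet> y = (\<Sum>p\<in>P. x $ p * y $ p)"
proof -
  have "x \<bullet> y = (\<Sum>p\<in>UNIV. x $ p * y $ p)"
    by (simp add: inner_vec_def)
  also have "\<dots> = (\<Sum>p\<in>P. x $ p * y $ p)"
    using assms by (intro sum.mono_neutral_right) auto
  finally show ?thesis .
qed

text \<open>
  The vector \<open>Q (u - u0)\<close> vanishes outside \<open>P\<close>, so expanding \<open>(u - u0) \<bullet> Q (u - u0) = 0\<close>
  leaves only products over \<open>P\<close>. The left-hand side is a positive combination of the coordinates
  of \<open>u\<close> and \<open>Q u\<close>, which is how the complementarity products on the right control them.
\<close>

lemma feasible_cross_sum:
  assumes "feasible u"
  shows "(\<Sum>p\<in>P. u $ p * (Q *v u0) $ p + (Q *v u) $ p * u0 $ p)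
    = (\<Sum>p\<in>P. u $ p * (Q *v u) $ p) + (\<Sum>p\<in>P. u0 $ p * (Q *v u0) $ p)"
proof -
  have "0 = (u - u0) \<bullet> (Q *v (u - u0))"
    by (simp only: skew_self)
  also have "\<dots> = (\<Sum>p\<in>P. (u - u0) $ p * (Q *v (u - u0)) $ p)"
    by (rule inner_eq_sum_cone)
      (use assms in \<open>simp add: feasible_def matrix_vector_mult_diff_distrib\<close>)
  also have "\<dots> = (\<Sum>p\<in>P. u $ p * (Q *v u) $ p) + (\<Sum>p\<in>P. u0 $ p * (Q *v u0) $ p)
      - (\<Sum>p\<in>P. u $ p * (Q *v u0) $ p + (Q *v u) $ p * u0 $ p)"
    by (simp add: matrix_vector_mult_diff_distrib algebra_simps sum.distrib sum_subtractf)
  finally show ?thesis by simp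
qed

text \<open>
  Quantitative nondegeneracy: an injective linear map on a finite-dimensional space is bounded
  below.
\<close>

lemma cone_and_image_control_norm:
  obtains B where "B > 0"
    "\<And>d. B * norm d \<le> norm ((\<chi> p. if p \<in> P then d $ p else 0) :: real^'p, Q *v d)"
proof -
  let ?f = "\<lambda>d. ((\<chi> p. if p \<in> P then d $ p else 0) :: real^'p, Q *v d)"
  have lin: "linear ?f"
    by (rule linearI)
      (auto simp: vec_eq_iff matrix_vector_right_distrib matrix_vector_mult_scaleR)
  have "inj ?f"
  proof (subst linear_injective_0[OF lin], intro allI impI)
    fix d assume "?f d = 0"
    then have cone: "(\<chi> p. if p \<in> P then d $ p else 0) = (0 :: real^'p)" and Qd: "Q *v d = 0"
      by (auto simp: prod_eq_iff)
    have "d $ p = 0" if "p \<in> P" for p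
      using arg_cong[OF cone, of "\<lambda>x. x $ p"] that by simp
    then show "d = 0"
      using Qd by (rule nondegenerate)
  qed
  with lin show ?thesis
    using linear_inj_bounded_below_pos that by blast
qed

text \<open>
  Positivity of all terms in \<open>feasible_cross_sum\<close> bounds each cone coordinate of \<open>u\<close> and of
  \<open>Q u\<close>; the remaining coordinates of \<open>Q u\<close> are prescribed, and those of \<open>u\<close> are then controlled
  by \<open>cone_and_image_control_norm\<close>.
\<close>

lemma feasible_bounded:
  obtains C where "\<And>u. \<lbrakk>feasible u; (\<Sum>p\<in>P. u $ p * (Q *v u) $ p) \<le> M\<rbrakk>
    \<Longrightarrow> norm (u, Q *v u) \<le> C"
proof -
  obtain B where B: "B > 0"
    "\<And>d. B * norm d \<le> norm ((\<chi> p. if p \<in> P then d $ p else 0) :: real^'p, Q *v d)"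
    using cone_and_image_control_norm by blast
  define S where "S = M + (\<Sum>p\<in>P. u0 $ p * (Q *v u0) $ p)"
  define L where "L = (\<Sum>p\<in>UNIV. \<bar>S / (Q *v u0) $ p\<bar> + \<bar>S / u0 $ p\<bar> + \<bar>(Q *v u0) $ p\<bar>)"
  define C where "C = 2 * real CARD('p) * L / B + real CARD('p) * L"
  have "norm (u, Q *v u) \<le> C"
    if u: "feasible u" and M: "(\<Sum>p\<in>P. u $ p * (Q *v u) $ p) \<le> M" for u
  proof -
    have pos: "u $ p > 0" "(Q *v u) $ p > 0" if "p \<in> P" for p
      using u that by (auto simp: feasible_def)
    have cross: "(\<Sum>p\<in>P. u $ p * (Q *v u0) $ p + (Q *v u) $ p * u0 $ p) \<le> S"
      unfolding feasible_cross_sum[OF u] S_def using M by simp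
    have summand_pos: "u $ p * (Q *v u0) $ p > 0" "(Q *v u) $ p * u0 $ p > 0" if "p \<in> P" for p
      using pos[OF that] u0_pos[OF that] Qu0_pos[OF that] by simp_all
    have summand: "u $ p * (Q *v u0) $ p \<le> S \<and> (Q *v u) $ p * u0 $ p \<le> S" if "p \<in> P" for p
    proof -
      have "u $ p * (Q *v u0) $ p + (Q *v u) $ p * u0 $ p
          \<le> (\<Sum>p\<in>P. u $ p * (Q *v u0) $ p + (Q *v u) $ p * u0 $ p)"
      proof (rule member_le_sum[OF that])
        show "0 \<le> u $ q * (Q *v u0) $ q + (Q *v u) $ q * u0 $ q" if "q \<in> P - {p}" for q
          using summand_pos[of q] that by simp
      qed simp
      then show ?thesis using cross summand_pos[OF that] by linarith
    qed
    have leL: "\<bar>S / (Q *v u0) $ p\<bar> + \<bar>S / u0 $ p\<bar> + \<bar>(Q *v u0) $ p\<bar> \<le> L" for p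
      unfolding L_def by (rule member_le_sum) auto
    have uL: "\<bar>u $ p\<bar> \<le> L" if "p \<in> P" for p
    proof -
      have "u $ p \<le> S / (Q *v u0) $ p"
        using summand[OF that] Qu0_pos[OF that] by (simp add: pos_le_divide_eq)
      with pos[OF that] leL[of p] show ?thesis by linarith
    qed
    have vL: "\<bar>(Q *v u) $ p\<bar> \<le> L" for p
    proof (cases "p \<in> P")
      case True
      have "(Q *v u) $ p \<le> S / u0 $ p"
        using summand[OF True] u0_pos[OF True] by (simp add: pos_le_divide_eq)
      with pos[OF True] leL[of p] show ?thesis by linarith
    next
      case False
      then have "(Q *v u) $ p = (Q *v u0) $ p" using u by (simp add: feasible_def)
      with leL[of p] show ?thesis by linarith
    qed
    have L0: "L \<ge> 0" using vL[of undefined] by linarith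
    have "norm (Q *v u) \<le> (\<Sum>p\<in>UNIV. \<bar>(Q *v u) $ p\<bar>)"
      by (rule norm_le_l1_cart)
    also have "\<dots> \<le> real CARD('p) * L"
      using sum_bounded_above[of UNIV "\<lambda>p. \<bar>(Q *v u) $ p\<bar>" L] vL by simp
    finally have v: "norm (Q *v u) \<le> real CARD('p) * L" .
    have "norm ((\<chi> p. if p \<in> P then u $ p else 0) :: real^'p)
        \<le> (\<Sum>p\<in>UNIV. \<bar>((\<chi> p. if p \<in> P then u $ p else 0) :: real^'p) $ p\<bar>)"
      by (rule norm_le_l1_cart)
    also have "\<dots> \<le> real CARD('p) * L"
      using sum_bounded_above[of UNIV "\<lambda>p. \<bar>((\<chi> p. if p \<in> P then u $ p else 0) :: real^'p) $ p\<bar>" L]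
        uL L0 by simp
    finally have w: "norm ((\<chi> p. if p \<in> P then u $ p else 0) :: real^'p) \<le> real CARD('p) * L" .
    have "B * norm u \<le> 2 * real CARD('p) * L"
      using B(2)[of u] norm_Pair_le[of "(\<chi> p. if p \<in> P then u $ p else 0) :: real^'p" "Q *v u"] v w
      by linarith
    then have "norm u \<le> 2 * real CARD('p) * L / B"
      using B(1) by (simp add: pos_le_divide_eq mult.commute)
    with v norm_Pair_le[of u "Q *v u"] show ?thesis
      by (simp add: C_def)
  qed
  then show ?thesis using that by blast
qed

text \<open>
  The linearised central path equations are uniquely solvable: if all the right-hand sides vanish,
  then \<open>0 = d \<bullet> Q d = - (\<Sum>p\<in>P. (Q u)\<^sub>p / u\<^sub>p * d\<^sub>p\<^sup>2)\<close>, so \<open>d\<close> vanishes on \<open>P\<close> together with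
  \<open>Q d\<close>, and nondegeneracy applies.
\<close>

lemma newton_direction:
  assumes "feasible u"
  obtains d where "\<And>p. p \<notin> P \<Longrightarrow> (Q *v d) $ p = 0"
    "\<And>p. p \<in> P \<Longrightarrow> u $ p * (Q *v d) $ p + (Q *v u) $ p * d $ p = h p"
proof -
  let ?f = "\<lambda>d. (\<chi> p. if p \<in> P then u $ p * (Q *v d) $ p + (Q *v u) $ p * d $ p
    else (Q *v d) $ p) :: real^'p"
  have lin: "linear ?f"
    by (rule linearI)
      (auto simp: vec_eq_iff matrix_vector_mult_scaleR matrix_vector_right_distrib algebra_simps)
  have "inj ?f"
  proof (subst linear_injective_0[OF lin], intro allI impI)
    fix d assume "?f d = 0"
    then have f: "?f d $ p = 0" for p by simp
    have out: "(Q *v d) $ p = 0" if "p \<notin> P" for p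
      using f[of p] that by simp
    have inn: "u $ p * (Q *v d) $ p = - ((Q *v u) $ p * d $ p)" if "p \<in> P" for p
      using f[of p] that by simp
    have pos: "u $ p > 0" "(Q *v u) $ p > 0" if "p \<in> P" for p
      using assms that by (auto simp: feasible_def)
    have "0 = (\<Sum>p\<in>P. d $ p * (Q *v d) $ p)"
      using inner_eq_sum_cone[of "Q *v d" d] out skew_self[of d] by simp
    also have "\<dots> = (\<Sum>p\<in>P. - ((Q *v u) $ p / u $ p * (d $ p)\<^sup>2))"
    proof (rule sum.cong)
      fix p assume p: "p \<in> P"
      have "(Q *v d) $ p = - ((Q *v u) $ p * d $ p) / u $ p"
        using inn[OF p] pos[OF p] by (simp add: field_simps)
      then show "d $ p * (Q *v d) $ p = - ((Q *v u) $ p / u $ p * (d $ p)\<^sup>2)"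
        by (simp add: power2_eq_square)
    qed simp
    finally have "(\<Sum>p\<in>P. (Q *v u) $ p / u $ p * (d $ p)\<^sup>2) = 0"
      by (simp add: sum_negf)
    moreover have "(Q *v u) $ p / u $ p * (d $ p)\<^sup>2 \<ge> 0" if "p \<in> P" for p
      using pos[OF that] by simp
    ultimately have zero: "(Q *v u) $ p / u $ p * (d $ p)\<^sup>2 = 0" if "p \<in> P" for p
      using that sum_nonneg_0[of P "\<lambda>p. (Q *v u) $ p / u $ p * (d $ p)\<^sup>2" p] finite by blast
    have dP: "d $ p = 0" if "p \<in> P" for p
      using zero[OF that] pos[OF that] by simp
    have "(Q *v d) $ p = 0" for p
      using out inn[of p] dP[of p] pos[of p] by (cases "p \<in> P") auto
    then have "Q *v d = 0" by (simp add: vec_eq_iff)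
    with dP show "d = 0" by (rule nondegenerate)
  qed
  then have "surj ?f"
    using lin linear_injective_imp_surjective by blast
  then obtain d where d: "(\<chi> p. if p \<in> P then h p else 0) = ?f d"
    by (rule surjE)
  show ?thesis
  proof
    show "(Q *v d) $ p = 0" if "p \<notin> P" for p
      using arg_cong[OF d, of "\<lambda>x. x $ p"] that by simp
    show "u $ p * (Q *v d) $ p + (Q *v u) $ p * d $ p = h p" if "p \<in> P" for p
      using arg_cong[OF d, of "\<lambda>x. x $ p"] that by simp
  qed
qed

text \<open>
  The primal-dual logarithmic barrier function with parameter \<open>\<nu>\<close>. The sum of the products is the
  duality gap; because of \<open>u \<bullet> Q u = 0\<close> it is linear in \<open>u\<close> on the feasible points.
\<close>

definition potential :: "real \<Rightarrow> real^'p \<Rightarrow> real"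
  where "potential \<nu> u = (\<Sum>p\<in>P. u $ p * (Q *v u) $ p - \<nu> * ln (u $ p * (Q *v u) $ p))"

text \<open>
  Since \<open>x - \<nu> ln x\<close> grows at least like \<open>x / 2\<close> and tends to infinity as \<open>x\<close> tends to zero, a bound on
  the potential keeps the products bounded and away from zero.
\<close>

lemma potential_sublevel:
  assumes \<nu>: "\<nu> > 0"
  obtains l M where "l > 0"
    "\<And>u. \<lbrakk>feasible u; potential \<nu> u \<le> E\<rbrakk> \<Longrightarrow>
      (\<forall>p\<in>P. l \<le> u $ p * (Q *v u) $ p) \<and> (\<Sum>p\<in>P. u $ p * (Q *v u) $ p) \<le> M"
proof -
  define m where "m = - (\<nu> * (ln (2 * \<nu>) - 1))"
  define M where "M = 2 * (E + real (card P) * \<bar>m\<bar>)"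
  define l where "l = exp (- (E + real (card P) * \<bar>m\<bar>) / \<nu>)"
  have lower: "x / 2 + m \<le> x - \<nu> * ln x" if "x > 0" for x
  proof -
    (* Scaling by 2 * \<nu> makes half of the linear term survive. *)
    have "ln (x / (2 * \<nu>)) \<le> x / (2 * \<nu>) - 1"
      using that \<nu> by (intro ln_le_minus_one) simp
    then have "ln x \<le> x / (2 * \<nu>) - 1 + ln (2 * \<nu>)"
      using that \<nu> by (simp add: ln_div)
    then have "\<nu> * ln x \<le> \<nu> * (x / (2 * \<nu>) - 1 + ln (2 * \<nu>))"
      using \<nu> by (intro mult_left_mono) auto
    also have "\<dots> = x / 2 - m"
      using \<nu> by (simp add: m_def algebra_simps)
    finally show ?thesis by linarith
  qed
  have "(\<forall>p\<in>P. l \<le> u $ p * (Q *v u) $ p) \<and> (\<Sum>p\<in>P. u $ p * (Q *v u) $ p) \<le> M"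
    if u: "feasible u" and E: "potential \<nu> u \<le> E" for u
  proof
    let ?x = "\<lambda>p. u $ p * (Q *v u) $ p"
    have pos: "?x p > 0" if "p \<in> P" for p
      using u that by (auto simp: feasible_def)
    have g: "?x p / 2 - \<bar>m\<bar> \<le> ?x p - \<nu> * ln (?x p)" if "p \<in> P" for p
      using lower[OF pos[OF that]] by linarith
    have "(\<Sum>p\<in>P. ?x p / 2 - \<bar>m\<bar>) \<le> potential \<nu> u"
      unfolding potential_def by (rule sum_mono) (rule g)
    then show "(\<Sum>p\<in>P. ?x p) \<le> M"
      using E by (simp add: M_def sum_subtractf sum_divide_distrib[symmetric])
    show "\<forall>p\<in>P. l \<le> ?x p"
    proof
      fix q assume q: "q \<in> P"
      have "(\<Sum>p\<in>P - {q}. - \<bar>m\<bar>) \<le> (\<Sum>p\<in>P - {q}. ?x p - \<nu> * ln (?x p))"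
      proof (rule sum_mono)
        fix p assume "p \<in> P - {q}"
        then show "- \<bar>m\<bar> \<le> ?x p - \<nu> * ln (?x p)"
          using g[of p] pos[of p] by auto
      qed
      moreover have "(\<Sum>p\<in>P - {q}. - \<bar>m\<bar>) \<ge> - (real (card P) * \<bar>m\<bar>)"
      proof -
        have "real (card (P - {q})) \<le> real (card P)"
          by (simp add: card_mono)
        then have "real (card (P - {q})) * \<bar>m\<bar> \<le> real (card P) * \<bar>m\<bar>"
          by (intro mult_right_mono) auto
        then show ?thesis by simp
      qed
      moreover have "potential \<nu> u = (?x q - \<nu> * ln (?x q)) + (\<Sum>p\<in>P - {q}. ?x p - \<nu> * ln (?x p))"
        unfolding potential_def using q by (simp add: sum.remove)
      ultimately have "- (\<nu> * ln (?x q)) \<le> E + real (card P) * \<bar>m\<bar>"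
        using E pos[OF q] by linarith
      then have "- (E + real (card P) * \<bar>m\<bar>) / \<nu> \<le> ln (?x q)"
        using \<nu> by (simp add: pos_divide_le_eq mult.commute) 
      then show "l \<le> ?x q"
        unfolding l_def using pos[OF q] by (metis exp_le_cancel_iff exp_ln)
    qed
  qed
  moreover have "l > 0" by (simp add: l_def)
  ultimately show ?thesis using that by blast
qed

text \<open>
  The sublevel set of \<open>u0\<close> lies in a compact set \<open>K\<close> of feasible points: the strict inequalities of
  feasibility are implied on \<open>K\<close> by closed conditions, because the products are at least \<open>l > 0\<close>.
\<close>

lemma potential_attains_min:
  assumes \<nu>: "\<nu> > 0"
  obtains u where "feasible u" "\<And>w. feasible w \<Longrightarrow> potential \<nu> u \<le> potential \<nu> w"
proof -
  obtain l M where l: "l > 0" and sub: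
    "\<And>u. \<lbrakk>feasible u; potential \<nu> u \<le> potential \<nu> u0\<rbrakk> \<Longrightarrow>
      (\<forall>p\<in>P. l \<le> u $ p * (Q *v u) $ p) \<and> (\<Sum>p\<in>P. u $ p * (Q *v u) $ p) \<le> M"
    using potential_sublevel[OF \<nu>, of "potential \<nu> u0"] by blast
  define K where "K = {u. (\<forall>p\<in>P. 0 \<le> u $ p \<and> 0 \<le> (Q *v u) $ p \<and> l \<le> u $ p * (Q *v u) $ p)
    \<and> (\<forall>p\<in>-P. (Q *v u) $ p = (Q *v u0) $ p) \<and> (\<Sum>p\<in>P. u $ p * (Q *v u) $ p) \<le> M}"
  have K_feasible: "feasible u" if "u \<in> K" for u
  proof -
    have "u $ p > 0 \<and> (Q *v u) $ p > 0" if p: "p \<in> P" for p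
    proof -
      have "0 \<le> u $ p" "0 \<le> (Q *v u) $ p" "u $ p * (Q *v u) $ p > 0"
        using \<open>u \<in> K\<close> p l unfolding K_def by force+
      then show ?thesis
        by (metis less_eq_real_def less_irrefl mult_zero_left mult_zero_right)
    qed
    with that show ?thesis by (auto simp: feasible_def K_def)
  qed
  have "closed K"
    unfolding K_def Ball_def
    by (intro closed_Collect_conj closed_Collect_all closed_Collect_le closed_Collect_eq
        closed_Collect_imp open_Collect_const continuous_intros)
  moreover have "bounded K"
  proof -
    obtain C where C: "\<And>u. \<lbrakk>feasible u; (\<Sum>p\<in>P. u $ p * (Q *v u) $ p) \<le> M\<rbrakk>
        \<Longrightarrow> norm (u, Q *v u) \<le> C"
      using feasible_bounded[of M] by blast
    have "norm u \<le> C" if "u \<in> K" for u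
    proof -
      have "norm (u, Q *v u) \<le> C"
        using C[OF K_feasible[OF that]] that by (simp add: K_def)
      with norm_fst_le[of u "Q *v u"] show ?thesis by simp
    qed
    then show ?thesis by (auto simp: bounded_iff)
  qed
  ultimately have "compact K" by (simp add: compact_eq_bounded_closed)
  have in_K: "u \<in> K" if "feasible u" "potential \<nu> u \<le> potential \<nu> u0" for u
    using sub[OF that] that(1) by (auto simp: K_def feasible_def less_imp_le)
  have "continuous_on K (potential \<nu>)"
    unfolding potential_def
  proof (intro continuous_intros)
    fix p assume "p \<in> P"
    show "\<forall>u\<in>K. u $ p * (Q *v u) $ p \<noteq> 0"
      using K_feasible \<open>p \<in> P\<close> by (fastforce simp: feasible_def)
  qed
  moreover have "u0 \<in> K" using in_K feasible_u0 by simp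
  ultimately obtain u where u: "u \<in> K" "\<And>w. w \<in> K \<Longrightarrow> potential \<nu> u \<le> potential \<nu> w"
    using continuous_attains_inf[OF \<open>compact K\<close>, of "potential \<nu>"] by blast
  show ?thesis
  proof
    show "feasible u" using K_feasible u(1) .
    show "potential \<nu> u \<le> potential \<nu> w" if "feasible w" for w
      using u(2)[of w] u(2)[OF \<open>u0 \<in> K\<close>] in_K[OF that] by fastforce
  qed
qed

text \<open>
  At a minimiser of the potential the derivative vanishes in every feasible direction. In the
  Newton direction towards \<open>\<nu>\<close>, along which each product \<open>x\<^sub>p\<close> changes at the rate \<open>\<nu> - x\<^sub>p\<close>, the
  derivative is \<open>- (\<Sum>p\<in>P. (x\<^sub>p - \<nu>)\<^sup>2 / x\<^sub>p)\<close>; it can be zero only if all products equal \<open>\<nu>\<close>.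
\<close>

lemma central_exists:
  assumes \<nu>: "\<nu> > 0"
  obtains u where "central \<nu> u"
proof -
  obtain u where u: "feasible u" and min: "\<And>w. feasible w \<Longrightarrow> potential \<nu> u \<le> potential \<nu> w"
    using potential_attains_min[OF \<nu>] by blast
  let ?x = "\<lambda>p. u $ p * (Q *v u) $ p"
  have pos: "u $ p > 0" "(Q *v u) $ p > 0" if "p \<in> P" for p
    using u that by (auto simp: feasible_def)
  obtain d where d_out: "\<And>p. p \<notin> P \<Longrightarrow> (Q *v d) $ p = 0"
    and d_in: "\<And>p. p \<in> P \<Longrightarrow> u $ p * (Q *v d) $ p + (Q *v u) $ p * d $ p = \<nu> - ?x p"
    using newton_direction[OF u, of "\<lambda>p. \<nu> - ?x p"] by blast
  have line: "Q *v (u + t *\<^sub>R d) = Q *v u + t *\<^sub>R (Q *v d)" for t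
    by (simp add: matrix_vector_right_distrib matrix_vector_mult_scaleR)
  have "\<forall>p\<in>P. \<forall>\<^sub>F t in nhds 0. u $ p + t * d $ p > 0 \<and> (Q *v u) $ p + t * (Q *v d) $ p > 0"
  proof
    fix p assume p: "p \<in> P"
    have "((\<lambda>t. u $ p + t * d $ p) \<longlongrightarrow> u $ p + 0 * d $ p) (nhds 0)"
      by (intro tendsto_intros filterlim_ident)
    moreover have "((\<lambda>t. (Q *v u) $ p + t * (Q *v d) $ p)
        \<longlongrightarrow> (Q *v u) $ p + 0 * (Q *v d) $ p) (nhds 0)"
      by (intro tendsto_intros filterlim_ident)
    ultimately show "\<forall>\<^sub>F t in nhds 0. u $ p + t * d $ p > 0 \<and> (Q *v u) $ p + t * (Q *v d) $ p > 0"
      using pos[OF p] by (intro eventually_conj order_tendstoD(1)[where y = "u $ p + 0 * d $ p"]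
        order_tendstoD(1)[where y = "(Q *v u) $ p + 0 * (Q *v d) $ p"]) auto
  qed
  then have "\<forall>\<^sub>F t in nhds 0. \<forall>p\<in>P. u $ p + t * d $ p > 0 \<and> (Q *v u) $ p + t * (Q *v d) $ p > 0"
    by (intro eventually_ball_finite) auto
  then have "\<forall>\<^sub>F t in nhds 0. feasible (u + t *\<^sub>R d)"
    by eventually_elim (use u d_out in \<open>simp add: feasible_def line\<close>)
  then obtain \<delta> where \<delta>: "\<delta> > 0" "\<And>t. \<bar>t\<bar> < \<delta> \<Longrightarrow> feasible (u + t *\<^sub>R d)"
    unfolding eventually_nhds_metric by (auto simp: dist_real_def)
  have "((\<lambda>t. potential \<nu> (u + t *\<^sub>R d)) has_real_derivative
      (\<Sum>p\<in>P. (1 - \<nu> / ?x p) * (\<nu> - ?x p))) (at 0)"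
    unfolding potential_def
  proof (rule DERIV_sum)
    fix p assume p: "p \<in> P"
    have "((\<lambda>t. (u $ p + t * d $ p) * ((Q *v u) $ p + t * (Q *v d) $ p)
          - \<nu> * ln ((u $ p + t * d $ p) * ((Q *v u) $ p + t * (Q *v d) $ p))) has_real_derivative
        (u $ p * (Q *v d) $ p + (Q *v u) $ p * d $ p)
          - \<nu> * ((u $ p * (Q *v d) $ p + (Q *v u) $ p * d $ p) / ?x p)) (at 0)"
      using pos[OF p] by (auto intro!: derivative_eq_intros simp: field_simps)
    then show "((\<lambda>t. (u + t *\<^sub>R d) $ p * (Q *v (u + t *\<^sub>R d)) $ p
          - \<nu> * ln ((u + t *\<^sub>R d) $ p * (Q *v (u + t *\<^sub>R d)) $ p)) has_real_derivative
        (1 - \<nu> / ?x p) * (\<nu> - ?x p)) (at 0)"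
      unfolding d_in[OF p] line by (simp add: algebra_simps)
  qed
  then have "(\<Sum>p\<in>P. (1 - \<nu> / ?x p) * (\<nu> - ?x p)) = 0"
    by (rule DERIV_local_min[OF _ \<delta>(1)]) (use min \<delta>(2) in auto)
  moreover have "(1 - \<nu> / ?x p) * (\<nu> - ?x p) = - ((?x p - \<nu>)\<^sup>2 / ?x p)" if "p \<in> P" for p
    using pos[OF that] by (simp add: field_simps power2_eq_square)
  ultimately have "(\<Sum>p\<in>P. (?x p - \<nu>)\<^sup>2 / ?x p) = 0"
    by (simp add: sum_negf)
  moreover have "(?x p - \<nu>)\<^sup>2 / ?x p \<ge> 0" if "p \<in> P" for p
    using pos[OF that] by simp
  ultimately have zero: "(?x p - \<nu>)\<^sup>2 / ?x p = 0" if "p \<in> P" for p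
    using that sum_nonneg_0[of P "\<lambda>p. (?x p - \<nu>)\<^sup>2 / ?x p" p] finite by blast
  have "\<forall>p\<in>P. ?x p = \<nu>"
  proof
    fix p assume p: "p \<in> P"
    show "?x p = \<nu>"
      using zero[OF p] pos[OF p] by simp
  qed
  with u have "central \<nu> u" by (simp add: central_def)
  then show ?thesis using that by blast
qed

lemma central_bounded:
  obtains C where "\<And>\<nu> u. \<lbrakk>central \<nu> u; \<nu> \<le> 1\<rbrakk> \<Longrightarrow> norm (u, Q *v u) \<le> C"
proof -
  obtain C where C: "\<And>u. \<lbrakk>feasible u; (\<Sum>p\<in>P. u $ p * (Q *v u) $ p) \<le> real (card P)\<rbrakk>
      \<Longrightarrow> norm (u, Q *v u) \<le> C"
    using feasible_bounded[of "real (card P)"] by blast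
  have "norm (u, Q *v u) \<le> C" if "central \<nu> u" "\<nu> \<le> 1" for \<nu> u
  proof (rule C)
    show "feasible u" using that by (simp add: central_def)
    have "(\<Sum>p\<in>P. u $ p * (Q *v u) $ p) = (\<Sum>p\<in>P. \<nu>)"
      by (rule sum.cong) (use that in \<open>auto simp: central_def\<close>)
    then show "(\<Sum>p\<in>P. u $ p * (Q *v u) $ p) \<le> real (card P)"
      using that by (simp add: mult_left_le)
  qed
  then show ?thesis using that by blast
qed

end

section \<open>The splitting step\<close>

lemma norm_Pair_sq: "(norm (a, b))\<^sup>2 = (norm a)\<^sup>2 + (norm b)\<^sup>2"
  by (simp add: norm_Pair)

text \<open>
  This is the algebraic core of the convergence proof. All vectors are deviations from a central
  point: \<open>a\<close>, \<open>b\<close> those of \<open>u\<close>, \<open>v\<close>, then \<open>t\<close> that of the resolvent output and \<open>a'\<close> that of the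
  new \<open>u\<close>. The hypothesis is skew-symmetry of \<open>Q\<close>, since \<open>a + b - t = Q t\<close>; the last term is
  nonpositive by antitonicity along the barrier curve.
\<close>

lemma splitting_norm_identity:
  fixes a b t a' :: "'a::real_inner"
  assumes "t \<bullet> (a + b - t) = 0"
  shows "(norm (a', b - t + a'))\<^sup>2 = (norm (a, b))\<^sup>2 - (norm (a - t))\<^sup>2 + 2 * (a' \<bullet> (b - t + a'))"
  using assms
  by (simp add: norm_Pair_sq power2_norm_eq_inner inner_commute algebra_simps)

text \<open>
  The update is the positive root of \<open>x (x - d) = \<nu>\<close>.
\<close>

lemma barrier_update_complementary:
  assumes "\<nu> > 0"
  shows "barrier_update \<nu> 1 d > 0" and "barrier_update \<nu> 1 d * (barrier_update \<nu> 1 d - d) = \<nu>"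
proof -
  have "\<bar>d\<bar> < sqrt (d * d + 4 * \<nu>)"
    using assms by (intro real_less_rsqrt) (simp add: power2_eq_square)
  then show "barrier_update \<nu> 1 d > 0"
    by (simp add: barrier_update_def)
  have "(sqrt (d * d + 4 * \<nu>))\<^sup>2 = d * d + 4 * \<nu>"
    using assms by (simp add: add_nonneg_nonneg)
  then show "barrier_update \<nu> 1 d * (barrier_update \<nu> 1 d - d) = \<nu>"
    by (simp add: barrier_update_def power2_eq_square field_simps)
qed

context skew_barrier
begin

definition predictor :: "(real^'p) \<times> (real^'p) \<Rightarrow> real^'p"
  where "predictor z = matrix_inv (mat 1 + Q) *v (fst z + snd z)"

definition step :: "real \<Rightarrow> (real^'p) \<times> (real^'p) \<Rightarrow> (real^'p) \<times> (real^'p)"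
  where "step \<nu> z =
    (let ut = predictor z;
         u' = (\<chi> p. if p \<in> P then barrier_update \<nu> 1 (ut $ p - snd z $ p) else ut $ p)
     in (u', snd z - ut + u'))"

text \<open>
  Outside \<open>P\<close> the second component is reset to the prescribed value of \<open>Q u\<close>. Every state on the
  barrier curve has this value there already, so the reset does not move it.
\<close>

definition warm_start :: "real \<Rightarrow> (real^'p) \<times> (real^'p) \<Rightarrow> (real^'p) \<times> (real^'p)"
  where "warm_start \<gamma> z =
    (sqrt \<gamma> *\<^sub>R fst z, \<chi> p. if p \<in> P then sqrt \<gamma> * snd z $ p else (Q *v u0) $ p)"

definition on_barrier :: "real \<Rightarrow> (real^'p) \<times> (real^'p) \<Rightarrow> bool"
  where "on_barrier \<nu> z \<longleftrightarrow> (\<forall>p\<in>P. fst z $ p > 0 \<and> fst z $ p * snd z $ p = \<nu>) \<and>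
    (\<forall>p. p \<notin> P \<longrightarrow> snd z $ p = (Q *v u0) $ p)"

lemma central_on_barrier: "central \<nu> w \<Longrightarrow> on_barrier \<nu> (w, Q *v w)"
  by (auto simp: central_def feasible_def on_barrier_def)

text \<open>
  On \<open>P\<close> the second component is \<open>\<nu>\<close> divided by the first, a decreasing function; outside \<open>P\<close> the
  second components agree.
\<close>

lemma on_barrier_antitone:
  assumes \<nu>: "\<nu> > 0" and z: "on_barrier \<nu> z" and z': "on_barrier \<nu> z'"
  shows "(fst z - fst z') \<bullet> (snd z - snd z') \<le> 0"
proof -
  have "(fst z - fst z') \<bullet> (snd z - snd z')
      = (\<Sum>p\<in>P. (fst z - fst z') $ p * (snd z - snd z') $ p)"
    by (rule inner_eq_sum_cone) (use z z' in \<open>auto simp: on_barrier_def\<close>)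
  also have "\<dots> \<le> 0"
  proof (rule sum_nonpos)
    fix p assume p: "p \<in> P"
    define x x' where "x = fst z $ p" and "x' = fst z' $ p"
    have x: "x > 0" "x' > 0"
      using z z' p by (auto simp: on_barrier_def x_def x'_def)
    have "x * snd z $ p = \<nu>" "x' * snd z' $ p = \<nu>"
      using z z' p by (auto simp: on_barrier_def x_def x'_def)
    then have s: "snd z $ p = \<nu> / x" "snd z' $ p = \<nu> / x'"
      using x by (auto simp: field_simps)
    have "(x - x') * (\<nu> / x - \<nu> / x') = - (\<nu> * (x - x')\<^sup>2 / (x * x'))"
      using x by (simp add: field_simps power2_eq_square)
    also have "\<dots> \<le> 0"
      using x \<nu> by simp
    finally show "(fst z - fst z') $ p * (snd z - snd z') $ p \<le> 0"
      using s by (simp add: x_def x'_def)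
  qed
  finally show ?thesis .
qed

text \<open>
  The matrix \<open>I + Q\<close> is invertible because \<open>x \<bullet> (I + Q) x = x \<bullet> x\<close>.
\<close>

lemma predictor_eq: "predictor z + Q *v predictor z = fst z + snd z"
proof -
  let ?M = "mat 1 + Q"
  have M: "?M *v x = x + Q *v x" for x
    by (simp add: matrix_vector_mult_add_rdistrib)
  have "\<exists>B. B ** ?M = mat 1"
    unfolding matrix_left_invertible_ker
  proof (intro allI impI)
    fix x assume "?M *v x = 0"
    then have "x \<bullet> (x + Q *v x) = 0" by (simp add: M)
    then show "x = 0" by (simp add: inner_add_right skew_self)
  qed
  then have "invertible ?M" by (simp add: invertible_left_inverse)
  then have "?M ** matrix_inv ?M = mat 1"
    unfolding invertible_def matrix_inv_def by (rule someI2_ex) simp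
  then have "?M *v predictor z = fst z + snd z"
    by (simp add: predictor_def matrix_vector_mul_assoc)
  then show ?thesis by (simp add: M)
qed

lemma step_on_barrier:
  assumes \<nu>: "\<nu> > 0" and z: "on_barrier \<nu> z"
  shows "on_barrier \<nu> (step \<nu> z)"
proof -
  have "fst (step \<nu> z) $ p > 0 \<and> fst (step \<nu> z) $ p * snd (step \<nu> z) $ p = \<nu>" if "p \<in> P" for p
  proof -
    define d where "d = predictor z $ p - snd z $ p"
    have "fst (step \<nu> z) $ p = barrier_update \<nu> 1 d"
      "snd (step \<nu> z) $ p = barrier_update \<nu> 1 d - d"
      using that by (simp_all add: step_def Let_def d_def)
    then show ?thesis
      using barrier_update_complementary[OF \<nu>, of d] by simp
  qed
  moreover have "snd (step \<nu> z) $ p = snd z $ p" if "p \<notin> P" for p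
    using that by (simp add: step_def Let_def)
  ultimately show ?thesis
    using z by (simp add: on_barrier_def)
qed

text \<open>
  The decrease of the squared distance to the central point pays for the progress made by the
  step.
\<close>

lemma step_dist_central:
  assumes \<nu>: "\<nu> > 0" and z: "on_barrier \<nu> z" and w: "central \<nu> w"
  shows "(norm (step \<nu> z - (w, Q *v w)))\<^sup>2
    \<le> (norm (z - (w, Q *v w)))\<^sup>2 - (norm (fst z - predictor z))\<^sup>2"
proof -
  define a b t a' where "a = fst z - w" and "b = snd z - Q *v w" and "t = predictor z - w"
    and "a' = fst (step \<nu> z) - w"
  have snd_step: "snd (step \<nu> z) - Q *v w = b - t + a'"
    by (simp add: a'_def b_def t_def step_def Let_def)
  have "a + b - t = Q *v t"
    using predictor_eq[of z]
    by (simp add: a_def b_def t_def matrix_vector_mult_diff_distrib algebra_simps)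
  then have orth: "t \<bullet> (a + b - t) = 0"
    by (simp add: skew_self)
  have "a' \<bullet> (b - t + a') \<le> 0"
    using on_barrier_antitone[OF \<nu> step_on_barrier[OF \<nu> z] central_on_barrier[OF w]]
    by (simp add: snd_step a'_def[symmetric])
  moreover have "step \<nu> z - (w, Q *v w) = (a', b - t + a')"
    using snd_step by (simp add: prod_eq_iff a'_def)
  moreover have "z - (w, Q *v w) = (a, b)"
    by (simp add: prod_eq_iff a_def b_def)
  moreover have "fst z - predictor z = a - t"
    by (simp add: a_def t_def)
  ultimately show ?thesis
    using splitting_norm_identity[OF orth, of a'] by simp
qed

text \<open>
  By \<open>predictor_eq\<close> the residual is \<open>(I + Q) d\<close> with \<open>d\<close> the displacement of the predictor, and
  \<open>d\<close> is orthogonal to \<open>Q d\<close>.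
\<close>

lemma residual_le:
  "(norm (Q *v fst z - snd z))\<^sup>2 \<le> (1 + (onorm ((*v) Q))\<^sup>2) * (norm (fst z - predictor z))\<^sup>2"
proof -
  let ?d = "fst z - predictor z"
  have "Q *v fst z - snd z = ?d + Q *v ?d"
    using predictor_eq[of z] by (simp add: matrix_vector_mult_diff_distrib algebra_simps)
  then have "(norm (Q *v fst z - snd z))\<^sup>2 = (norm ?d)\<^sup>2 + (norm (Q *v ?d))\<^sup>2"
    using skew_self[of ?d] by (simp add: power2_norm_eq_inner inner_add inner_commute)
  moreover have "norm (Q *v ?d) \<le> onorm ((*v) Q) * norm ?d"
    by (intro onorm matrix_vector_mul_bounded_linear)
  then have "(norm (Q *v ?d))\<^sup>2 \<le> (onorm ((*v) Q))\<^sup>2 * (norm ?d)\<^sup>2"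
    by (metis norm_ge_zero power_mono power_mult_distrib)
  ultimately show ?thesis by (simp add: distrib_right)
qed

lemma iterates_on_barrier:
  "\<lbrakk>\<nu> > 0; on_barrier \<nu> z\<rbrakk> \<Longrightarrow> on_barrier \<nu> ((step \<nu> ^^ n) z)"
  by (induction n) (auto intro: step_on_barrier)

lemma iterates_dist_central:
  assumes \<nu>: "\<nu> > 0" and z: "on_barrier \<nu> z" and w: "central \<nu> w"
  shows "(norm ((step \<nu> ^^ n) z - (w, Q *v w)))\<^sup>2
      + (\<Sum>i<n. (norm (fst ((step \<nu> ^^ i) z) - predictor ((step \<nu> ^^ i) z)))\<^sup>2)
    \<le> (norm (z - (w, Q *v w)))\<^sup>2"
proof (induction n)
  case (Suc n)
  then show ?case
    using step_dist_central[OF \<nu> iterates_on_barrier[OF \<nu> z] w, of n] by simp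
qed simp

lemma iterates_dist_central_le:
  assumes \<nu>: "\<nu> > 0" and z: "on_barrier \<nu> z" and w: "central \<nu> w"
  shows "norm ((step \<nu> ^^ n) z - (w, Q *v w)) \<le> norm (z - (w, Q *v w))"
proof (rule power2_le_imp_le)
  have "0 \<le> (\<Sum>i<n. (norm (fst ((step \<nu> ^^ i) z) - predictor ((step \<nu> ^^ i) z)))\<^sup>2)"
    by (intro sum_nonneg) simp
  with iterates_dist_central[OF assms, of n]
  show "(norm ((step \<nu> ^^ n) z - (w, Q *v w)))\<^sup>2 \<le> (norm (z - (w, Q *v w)))\<^sup>2"
    by linarith
qed simp

text \<open>
  Every step from a state with a large residual uses up a fixed amount of the squared distance to
  the central point.
\<close>

lemma number_of_large_residuals:
  assumes \<nu>: "\<nu> > 0" and z: "on_barrier \<nu> z" and w: "central \<nu> w"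
    and large: "\<And>i. i < n \<Longrightarrow>
      (norm (Q *v fst ((step \<nu> ^^ i) z) - snd ((step \<nu> ^^ i) z)))\<^sup>2 > \<mu>"
  shows "real n * \<mu> \<le> (1 + (onorm ((*v) Q))\<^sup>2) * (norm (z - (w, Q *v w)))\<^sup>2"
proof -
  let ?z = "\<lambda>i. (step \<nu> ^^ i) z" and ?L = "1 + (onorm ((*v) Q))\<^sup>2"
  have "real n * \<mu> = (\<Sum>i<n. \<mu>)" by simp
  also have "\<dots> \<le> (\<Sum>i<n. ?L * (norm (fst (?z i) - predictor (?z i)))\<^sup>2)"
  proof (rule sum_mono)
    fix i assume "i \<in> {..<n}"
    then show "\<mu> \<le> ?L * (norm (fst (?z i) - predictor (?z i)))\<^sup>2"
      using large[of i] residual_le[of "?z i"] by simp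
  qed
  also have "\<dots> = ?L * (\<Sum>i<n. (norm (fst (?z i) - predictor (?z i)))\<^sup>2)"
    by (simp add: sum_distrib_left)
  also have "\<dots> \<le> ?L * (norm (z - (w, Q *v w)))\<^sup>2"
  proof (rule mult_left_mono)
    have "0 \<le> (norm (?z n - (w, Q *v w)))\<^sup>2" by simp
    then show "(\<Sum>i<n. (norm (fst (?z i) - predictor (?z i)))\<^sup>2) \<le> (norm (z - (w, Q *v w)))\<^sup>2"
      using iterates_dist_central[OF \<nu> z w, of n] by linarith
  qed simp
  finally show ?thesis .
qed

lemma warm_start_on_barrier:
  assumes \<gamma>: "\<gamma> > 0" and z: "on_barrier \<nu> z"
  shows "on_barrier (\<gamma> * \<nu>) (warm_start \<gamma> z)"
proof -
  have "sqrt \<gamma> * x * (sqrt \<gamma> * y) = (sqrt \<gamma> * sqrt \<gamma>) * (x * y)" for x y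
    by (simp only: mult_ac)
  then have "sqrt \<gamma> * x * (sqrt \<gamma> * y) = \<gamma> * (x * y)" for x y
    using \<gamma> by simp
  then show ?thesis
    using \<gamma> z unfolding on_barrier_def warm_start_def by auto
qed

lemma warm_start_contraction:
  assumes \<gamma>: "0 < \<gamma>"
  shows "norm (warm_start \<gamma> z - warm_start \<gamma> z') \<le> sqrt \<gamma> * norm (z - z')"
proof -
  define x where "x = warm_start \<gamma> z - warm_start \<gamma> z'"
  have "norm (snd x) \<le> norm (sqrt \<gamma> *\<^sub>R (snd z - snd z'))"
    using \<gamma> by (intro norm_le_componentwise_cart)
      (simp add: x_def warm_start_def abs_mult right_diff_distrib[symmetric])
  then have "(norm (snd x))\<^sup>2 \<le> (sqrt \<gamma> * norm (snd z - snd z'))\<^sup>2"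
    using \<gamma> by (intro power_mono) auto
  moreover have "fst x = sqrt \<gamma> *\<^sub>R (fst z - fst z')"
    by (simp add: x_def warm_start_def scaleR_diff_right)
  then have "(norm (fst x))\<^sup>2 = (sqrt \<gamma> * norm (fst z - fst z'))\<^sup>2"
    using \<gamma> by simp
  moreover have "(norm x)\<^sup>2 = (norm (fst x))\<^sup>2 + (norm (snd x))\<^sup>2"
    "(norm (z - z'))\<^sup>2 = (norm (fst z - fst z'))\<^sup>2 + (norm (snd z - snd z'))\<^sup>2"
    using norm_Pair_sq[of "fst x" "snd x", unfolded prod.collapse]
      norm_Pair_sq[of "fst (z - z')" "snd (z - z')", unfolded prod.collapse] by simp_all
  ultimately have "(norm x)\<^sup>2 \<le> (sqrt \<gamma> * norm (z - z'))\<^sup>2"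
    by (simp add: power_mult_distrib distrib_left)
  then show ?thesis
    unfolding x_def[symmetric] by (rule power2_le_imp_le) (use \<gamma> in simp)
qed

lemma warm_start_norm_le:
  assumes \<gamma>: "0 < \<gamma>" "\<gamma> < 1" and z: "on_barrier \<nu> z"
  shows "norm (warm_start \<gamma> z) \<le> norm z"
proof -
  have sq: "sqrt \<gamma> \<le> 1" using \<gamma> by simp
  have "norm (fst (warm_start \<gamma> z)) \<le> norm (fst z)"
    using \<gamma> sq by (simp add: warm_start_def mult_left_le_one_le)
  moreover have "norm (snd (warm_start \<gamma> z)) \<le> norm (snd z)"
  proof (rule norm_le_componentwise_cart)
    show "norm (snd (warm_start \<gamma> z) $ p) \<le> norm (snd z $ p)" for p
      using \<gamma> sq z by (auto simp: warm_start_def on_barrier_def abs_mult mult_left_le_one_le)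
  qed
  ultimately have "(norm (warm_start \<gamma> z))\<^sup>2 \<le> (norm z)\<^sup>2"
    using norm_Pair_sq[of "fst (warm_start \<gamma> z)" "snd (warm_start \<gamma> z)"]
      norm_Pair_sq[of "fst z" "snd z"]
    by (simp add: add_mono power_mono)
  then show ?thesis
    by (rule power2_le_imp_le) simp
qed

text \<open>
  The distance of the \<open>k\<close>-th start to its central point satisfies a linear recursion with
  contraction factor \<open>\<surd>\<gamma> < 1\<close>: the warm start contracts towards the image of the old central
  point, and that image is within \<open>2 C\<close> of the new one because both have norm at most \<open>C\<close>. The
  inner iteration counts \<open>N\<close> are arbitrary, since inner steps never increase the distance; the
  bound is therefore available before termination of the inner loops is known.
\<close>

lemma outer_starts_near_central:
  assumes \<gamma>: "0 < \<gamma>" "\<gamma> < 1"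
    and Z0: "on_barrier 1 (Z 0)"
    and Z_Suc: "\<And>k. Z (Suc k) = warm_start \<gamma> ((step (\<gamma> ^ k) ^^ N k) (Z k))"
  obtains R where "\<And>k. on_barrier (\<gamma> ^ k) (Z k)"
    "\<And>k. \<exists>w. central (\<gamma> ^ k) w \<and> norm (Z k - (w, Q *v w)) \<le> R"
proof -
  obtain C where C: "\<And>\<nu> u. \<lbrakk>central \<nu> u; \<nu> \<le> 1\<rbrakk> \<Longrightarrow> norm (u, Q *v u) \<le> C"
    using central_bounded by blast
  have pow: "\<gamma> ^ k > 0" "\<gamma> ^ k \<le> 1" for k
    using \<gamma> by (auto simp: power_le_one)
  have "\<exists>w. central (\<gamma> ^ k) w" for k
    using central_exists[OF pow(1)[of k]] by blast
  then obtain w where w: "\<And>k. central (\<gamma> ^ k) (w k)"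
    by metis
  have wC: "norm (w k, Q *v w k) \<le> C" for k
    using C[OF w pow(2)] .
  have C0: "C \<ge> 0" using wC[of 0] norm_ge_zero order_trans by blast
  (* The second summand is the fixed point of the recursion D \<mapsto> \<surd>\<gamma> D + 2 C. *)
  define R where "R = norm (Z 0 - (w 0, Q *v w 0)) + 2 * C / (1 - sqrt \<gamma>)"
  have sq: "0 < sqrt \<gamma>" "sqrt \<gamma> < 1" using \<gamma> by auto
  have barrier: "on_barrier (\<gamma> ^ k) (Z k)" for k
  proof (induction k)
    case (Suc k)
    then show ?case
      using warm_start_on_barrier[OF \<gamma>(1) iterates_on_barrier[OF pow(1) Suc, of "N k"]]
      by (simp add: Z_Suc)
  qed (use Z0 in simp)
  have "norm (Z k - (w k, Q *v w k)) \<le> R" for k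
  proof (induction k)
    case 0
    then show ?case using C0 sq by (simp add: R_def)
  next
    case (Suc k)
    let ?c = "\<lambda>k. (w k, Q *v w k)" and ?y = "(step (\<gamma> ^ k) ^^ N k) (Z k)"
    have "Z (Suc k) - ?c (Suc k)
        = (warm_start \<gamma> ?y - warm_start \<gamma> (?c k)) + (warm_start \<gamma> (?c k) - ?c (Suc k))"
      by (simp add: Z_Suc)
    then have "norm (Z (Suc k) - ?c (Suc k))
        \<le> norm (warm_start \<gamma> ?y - warm_start \<gamma> (?c k)) + norm (warm_start \<gamma> (?c k) - ?c (Suc k))"
      by (metis norm_triangle_ineq)
    moreover have "norm (warm_start \<gamma> ?y - warm_start \<gamma> (?c k)) \<le> sqrt \<gamma> * R"
    proof -
      have "norm (?y - ?c k) \<le> R"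
        using iterates_dist_central_le[OF pow(1) barrier[of k] w, of "N k"] Suc by linarith
      then have "sqrt \<gamma> * norm (?y - ?c k) \<le> sqrt \<gamma> * R"
        using sq by (intro mult_left_mono) auto
      then show ?thesis
        using warm_start_contraction[OF \<gamma>(1)] order_trans by blast
    qed
    moreover have "norm (warm_start \<gamma> (?c k) - ?c (Suc k)) \<le> 2 * C"
      using norm_triangle_ineq4[of "warm_start \<gamma> (?c k)" "?c (Suc k)"]
        warm_start_norm_le[OF \<gamma> central_on_barrier[OF w[of k]]] wC[of k] wC[of "Suc k"]
      by linarith
    moreover have "sqrt \<gamma> * R + 2 * C \<le> R"
    proof -
      have "2 * C = (1 - sqrt \<gamma>) * (2 * C / (1 - sqrt \<gamma>))"
        using sq by simp
      also have "\<dots> \<le> (1 - sqrt \<gamma>) * R"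
        using sq by (intro mult_left_mono) (auto simp: R_def)
      finally show ?thesis by (simp add: algebra_simps)
    qed
    ultimately show ?case by linarith
  qed
  then show ?thesis using that barrier w by blast
qed

end

section \<open>The self-dual embedding\<close>

fun cone_block :: "('m, 'n) blk \<Rightarrow> bool"
where
  "cone_block (BY i) = False"
| "cone_block (BX j) = True"
| "cone_block BTau = True"
| "cone_block BTheta = False"

abbreviation cone :: "('m, 'n) blk set"
  where "cone \<equiv> Collect cone_block"

lemma sum_blk:
  fixes f :: "('m::finite, 'n::finite) blk \<Rightarrow> 'a::comm_monoid_add"
  shows "(\<Sum>p\<in>UNIV. f p) = (\<Sum>i\<in>UNIV. f (BY i)) + (\<Sum>j\<in>UNIV. f (BX j)) + f BTau + f BTheta"
proof -
  have "(\<Sum>p\<in>UNIV. f p) = sum f (range BY \<union> range BX) + sum f {BTau, BTheta}"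
    unfolding UNIV_blk by (rule sum.union_disjoint) auto
  also have "sum f (range BY \<union> range BX) = sum f (range BY) + sum f (range BX)"
    by (rule sum.union_disjoint) auto
  also have "sum f (range BY) = (\<Sum>i\<in>UNIV. f (BY i))"
    by (simp add: sum.reindex inj_on_def)
  also have "sum f (range BX) = (\<Sum>j\<in>UNIV. f (BX j))"
    by (simp add: sum.reindex inj_on_def)
  finally show ?thesis by (simp add: add.assoc)
qed

lemma transpose_Q_mat: "transpose (Q_mat A b c) = - Q_mat A b c"
proof -
  have "transpose (Q_mat A b c) $ p $ q = (- Q_mat A b c) $ p $ q" for p q
    by (cases p; cases q) (simp_all add: transpose_def Q_mat_def)
  then show ?thesis by (simp only: vec_eq_iff) simp
qed

text \<open>
  The barred data are defined so that the initial state solves the embedding exactly. As all its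
  cone coordinates are 1, it is the central point for \<open>\<nu> = 1\<close>.
\<close>

lemma Q_mat_initial:
  fixes A :: "real^'n^'m"
  shows "Q_mat A b c *v fst initial_state = snd initial_state"
proof -
  have "(Q_mat A b c *v fst initial_state) $ p = snd initial_state $ p" for p
    by (cases p)
      (simp_all add: matrix_vector_mult_def Q_mat_def initial_state_def sum_blk sum_negf
        sum_subtractf b_bar_def c_bar_def z_bar_def inner_vec_def)
  then show ?thesis by (simp add: vec_eq_iff)
qed

text \<open>
  Let \<open>u0\<close> be the initial point. Skew-symmetry gives \<open>0 = u0 \<bullet> Q d = - (Q u0 \<bullet> d)\<close>, and \<open>d\<close> has
  only \<open>y\<close> and \<open>\<theta>\<close> components, on which \<open>Q u0\<close> is zero and \<open>- n - 1\<close>, respectively; so the \<open>\<theta>\<close>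
  component of \<open>d\<close> vanishes. The \<open>x\<close> rows of \<open>Q d = 0\<close> then say that \<open>A\<close> transposed annihilates the
  \<open>y\<close> component, and full row rank finishes the proof.
\<close>

lemma Q_mat_nondegenerate:
  fixes A :: "real^'n^'m"
  assumes rank: "rank A = CARD('m)"
    and cone: "\<And>p. p \<in> cone \<Longrightarrow> d $ p = 0" and ker: "Q_mat A b c *v d = 0"
  shows "d = 0"
proof -
  have dx: "d $ BX j = 0" "d $ BTau = 0" for j
    using cone by auto
  have "fst initial_state \<bullet> (Q_mat A b c *v d) = - ((Q_mat A b c *v fst initial_state) \<bullet> d)"
    by (rule inner_skew_matrix[OF transpose_Q_mat])
  then have "snd (initial_state :: ('m, 'n) state) \<bullet> d = 0"
    using ker by (simp add: Q_mat_initial)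
  then have "(- real CARD('n) - 1) * d $ BTheta = 0"
    by (simp add: inner_vec_def sum_blk initial_state_def dx)
  then have dth: "d $ BTheta = 0" by auto
  have "(transpose A *v (\<chi> i. d $ BY i)) $ j = 0" for j
  proof -
    have "(Q_mat A b c *v d) $ BX j = 0" by (simp add: ker)
    then have "(\<Sum>i\<in>UNIV. A $ i $ j * d $ BY i) = 0"
      by (simp add: matrix_vector_mult_def Q_mat_def sum_blk dx dth sum_negf)
    then show ?thesis
      by (simp add: vector_matrix_mult_def mult.commute)
  qed
  then have "transpose A *v (\<chi> i. d $ BY i) = transpose A *v 0"
    by (simp add: vec_eq_iff)
  moreover have "inj ((*v) (transpose A))"
    using rank by (simp only: full_rank_injective[symmetric] rank_transpose)
  ultimately have "(\<chi> i. d $ BY i) = 0"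
    by (blast dest: injD)
  then have "d $ BY i = 0" for i
    by (simp add: vec_eq_iff)
  then have "d $ p = 0" for p
    using dx dth by (cases p) auto
  then show ?thesis by (simp add: vec_eq_iff)
qed

lemma skew_barrier_Q_mat:
  fixes A :: "real^'n^'m"
  assumes "rank A = CARD('m)"
  shows "skew_barrier (Q_mat A b c) cone (fst initial_state)"
proof
  show "transpose (Q_mat A b c) = - Q_mat A b c" by (rule transpose_Q_mat)
  fix p :: "('m, 'n) blk" assume "p \<in> cone"
  then show "0 < fst initial_state $ p" "0 < (Q_mat A b c *v fst initial_state) $ p"
    unfolding Q_mat_initial by (cases p; simp add: initial_state_def)+
next
  fix d assume "\<And>p. p \<in> cone \<Longrightarrow> d $ p = 0" "Q_mat A b c *v d = 0"
  then show "d = 0" using Q_mat_nondegenerate[OF assms] by blast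
qed

lemma mu_eq: "mu \<beta> \<gamma> k = \<beta> * \<gamma> ^ k"
  by (induction k) auto

text \<open>
  The abstract theory applies with \<open>\<nu> = \<mu>\<^sup>k / \<beta> = \<gamma>\<^sup>k\<close>. The bound on the number of large residuals
  yields first termination of the inner loop, and then, as all iterates before the stopping index
  fail the test, the bound on its length.
\<close>

lemma N_inner_bounded:
  fixes A :: "real^'n^'m" and b :: "real^'m" and c :: "real^'n" and \<beta> \<gamma> :: real
  assumes rank: "rank A = CARD('m)" and \<beta>: "\<beta> > 0" and \<gamma>: "0 < \<gamma>" "\<gamma> < 1"
  obtains K where "\<And>k. \<exists>i. inner_stop A b c (mu \<beta> \<gamma> k) (iterate A b c \<beta> \<gamma> k i)"
    "\<And>k. real (N_inner A b c \<beta> \<gamma> k) * mu \<beta> \<gamma> k \<le> K"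
proof -
  let ?Q = "Q_mat A b c"
  interpret skew_barrier ?Q cone "fst initial_state"
    using rank by (rule skew_barrier_Q_mat)
  have step_eq: "admm_step A b c \<beta> (mu \<beta> \<gamma> k) = step (\<gamma> ^ k)" for k
  proof
    fix z
    have upd: "barrier_update (mu \<beta> \<gamma> k) \<beta> d = barrier_update (\<gamma> ^ k) 1 d" for d
      using \<beta> by (simp add: barrier_update_def mu_eq)
    have blocks: "(\<chi> p. case p of BY i \<Rightarrow> ut $ BY i
          | BX j \<Rightarrow> barrier_update (mu \<beta> \<gamma> k) \<beta> (ut $ BX j - v $ BX j)
          | BTau \<Rightarrow> barrier_update (mu \<beta> \<gamma> k) \<beta> (ut $ BTau - v $ BTau)
          | BTheta \<Rightarrow> ut $ BTheta)
        = (\<chi> p. if p \<in> cone then barrier_update (\<gamma> ^ k) 1 (ut $ p - v $ p) else ut $ p)"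
      for ut v :: "real^('m, 'n) blk"
      by (auto simp: vec_eq_iff upd split: blk.split)
    show "admm_step A b c \<beta> (mu \<beta> \<gamma> k) z = step (\<gamma> ^ k) z"
      unfolding admm_step_def step_def predictor_def Let_def case_prod_beta blocks ..
  qed
  have restart_eq: "restart \<gamma> = warm_start \<gamma>"
  proof
    fix z :: "('m, 'n) state"
    show "restart \<gamma> z = warm_start \<gamma> z"
      unfolding restart_def warm_start_def Q_mat_initial case_prod_beta
      by (auto simp: initial_state_def vec_eq_iff split: blk.split)
  qed
  let ?Z = "outer_start A b c \<beta> \<gamma>"
  have "on_barrier 1 (?Z 0)"
    unfolding on_barrier_def Q_mat_initial outer_start.simps
    by (auto simp: initial_state_def split: blk.split)
  moreover have "?Z (Suc k) = warm_start \<gamma> ((step (\<gamma> ^ k) ^^ N_inner A b c \<beta> \<gamma> k) (?Z k))" for k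
    by (simp add: Let_def step_eq restart_eq N_inner_def del: mu.simps)
  ultimately obtain R where R: "\<And>k. on_barrier (\<gamma> ^ k) (?Z k)"
    "\<And>k. \<exists>w. central (\<gamma> ^ k) w \<and> norm (?Z k - (w, ?Q *v w)) \<le> R"
    using outer_starts_near_central[OF \<gamma>, of ?Z "N_inner A b c \<beta> \<gamma>"] by blast
  define L where "L = 1 + (onorm ((*v) ?Q))\<^sup>2"
  have L: "L > 0" by (simp add: L_def add_pos_nonneg)
  have bound: "real n * mu \<beta> \<gamma> k \<le> L * R\<^sup>2"
    if "\<And>i. i < n \<Longrightarrow> \<not> inner_stop A b c (mu \<beta> \<gamma> k) (iterate A b c \<beta> \<gamma> k i)" for n k
  proof -
    obtain w where w: "central (\<gamma> ^ k) w" "norm (?Z k - (w, ?Q *v w)) \<le> R"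
      using R(2) by blast
    have "real n * mu \<beta> \<gamma> k \<le> L * (norm (?Z k - (w, ?Q *v w)))\<^sup>2"
      unfolding L_def
      by (rule number_of_large_residuals[OF zero_less_power[OF \<gamma>(1)] R(1) w(1)])
        (use that in \<open>simp add: inner_stop_def iterate_def step_eq case_prod_beta not_le\<close>)
    also have "\<dots> \<le> L * R\<^sup>2"
      using w(2) L by (intro mult_left_mono power_mono) auto
    finally show ?thesis .
  qed
  have stops: "\<exists>i. inner_stop A b c (mu \<beta> \<gamma> k) (iterate A b c \<beta> \<gamma> k i)" for k
  proof (rule ccontr)
    assume never: "\<not> ?thesis"
    have "mu \<beta> \<gamma> k > 0" using \<beta> \<gamma> by (simp add: mu_eq)
    then obtain n where "real n * mu \<beta> \<gamma> k > L * R\<^sup>2"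
      using reals_Archimedean3 by blast
    with bound[of n k] never show False by auto
  qed
  have count: "real (N_inner A b c \<beta> \<gamma> k) * mu \<beta> \<gamma> k \<le> L * R\<^sup>2" for k
  proof (rule bound)
    fix i assume "i < N_inner A b c \<beta> \<gamma> k"
    then show "\<not> inner_stop A b c (mu \<beta> \<gamma> k) (iterate A b c \<beta> \<gamma> k i)"
      unfolding N_inner_def inner_count_def iterate_def by (rule not_less_Least)
  qed
  show ?thesis using that[OF stops count] .
qed

section \<open>Counting iterations\<close>

text \<open>
  Minimality of the index gives \<open>\<beta> \<gamma>\<^sup>j \<ge> \<epsilon>\<close> for its predecessor \<open>j\<close>, which exists because
  \<open>\<epsilon> \<le> \<beta>\<close>.
\<close>

lemma mu_stopping_index:
  assumes \<beta>: "\<beta> > 0" and \<gamma>: "0 < \<gamma>" "\<gamma> < 1" and \<epsilon>: "0 < \<epsilon>" "\<epsilon> \<le> \<beta>"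
  defines "K \<equiv> LEAST k. mu \<beta> \<gamma> k < \<epsilon>"
  shows "real K \<le> 1 + (ln \<beta> + ln (1 / \<epsilon>)) / ln (1 / \<gamma>)" and "mu \<beta> \<gamma> K \<ge> \<gamma> * \<epsilon>"
proof -
  have "\<exists>k. \<gamma> ^ k < \<epsilon> / \<beta>"
    using real_arch_pow_inv[of "\<epsilon> / \<beta>" \<gamma>] \<beta> \<gamma> \<epsilon> by simp
  then have ex: "\<exists>k. mu \<beta> \<gamma> k < \<epsilon>"
    using \<beta> by (simp add: mu_eq pos_less_divide_eq mult.commute)
  have "mu \<beta> \<gamma> K < \<epsilon>"
    unfolding K_def using ex by (rule LeastI_ex)
  then obtain j where j: "K = Suc j"
    using \<epsilon>(2) by (cases K) auto
  have large: "mu \<beta> \<gamma> j \<ge> \<epsilon>"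
    using not_less_Least[of j "\<lambda>k. mu \<beta> \<gamma> k < \<epsilon>"] j by (simp add: K_def not_less)
  show "mu \<beta> \<gamma> K \<ge> \<gamma> * \<epsilon>"
    using large \<gamma> by (simp add: j)
  have "ln \<epsilon> \<le> ln (\<beta> * \<gamma> ^ j)"
    using large \<epsilon> \<beta> \<gamma> by (subst ln_le_cancel_iff) (auto simp: mu_eq)
  also have "\<dots> = ln \<beta> - real j * ln (1 / \<gamma>)"
    using \<beta> \<gamma> by (simp add: ln_mult ln_realpow ln_div)
  finally have "real j * ln (1 / \<gamma>) \<le> ln \<beta> + ln (1 / \<epsilon>)"
    using \<epsilon> by (simp add: ln_div)
  moreover have "ln (1 / \<gamma>) > 0" using \<gamma> by simp
  ultimately have "real j \<le> (ln \<beta> + ln (1 / \<epsilon>)) / ln (1 / \<gamma>)"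
    by (simp add: pos_le_divide_eq)
  then show "real K \<le> 1 + (ln \<beta> + ln (1 / \<epsilon>)) / ln (1 / \<gamma>)"
    by (simp add: j)
qed

lemma filterlim_ln_inverse: "filterlim (\<lambda>\<epsilon>::real. ln (1 / \<epsilon>)) at_top (at_right 0)"
  using filterlim_compose[OF ln_at_top filterlim_inverse_at_top_right]
  by (simp add: inverse_eq_divide)

lemma T_IPM_bigo:
  assumes "\<beta> > 0" "0 < \<gamma>" "\<gamma> < 1"
  shows "(\<lambda>\<epsilon>. real (T_IPM \<beta> \<gamma> \<epsilon>)) \<in> O[at_right 0](\<lambda>\<epsilon>. ln (1 / \<epsilon>))"
proof (rule bigoI)
  define C where "C = 2 + (\<bar>ln \<beta>\<bar> + 1) / ln (1 / \<gamma>)"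
  have g: "ln (1 / \<gamma>) > 0" using assms by simp
  have "\<forall>\<^sub>F \<epsilon> in at_right 0. ln (1 / \<epsilon>) \<ge> (1::real)"
    using filterlim_ln_inverse by (simp add: filterlim_at_top)
  moreover have "\<forall>\<^sub>F \<epsilon> in at_right 0. \<epsilon> < \<beta>" "\<forall>\<^sub>F \<epsilon> in at_right 0. (0::real) < \<epsilon>"
    using assms eventually_at_right_less[of "0::real"] by (auto simp: eventually_at_right_field)
  ultimately show "\<forall>\<^sub>F \<epsilon> in at_right 0. norm (real (T_IPM \<beta> \<gamma> \<epsilon>)) \<le> C * norm (ln (1 / \<epsilon>))"
  proof eventually_elim
    case (elim \<epsilon>)
    have "real (T_IPM \<beta> \<gamma> \<epsilon>) \<le> 2 + (ln \<beta> + ln (1 / \<epsilon>)) / ln (1 / \<gamma>)"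
      using mu_stopping_index(1)[OF assms, of \<epsilon>] elim by (simp add: T_IPM_def)
    also have "\<dots> \<le> 2 * ln (1 / \<epsilon>) + (\<bar>ln \<beta>\<bar> * ln (1 / \<epsilon>) + ln (1 / \<epsilon>)) / ln (1 / \<gamma>)"
    proof (intro add_mono divide_right_mono)
      have "ln \<beta> \<le> \<bar>ln \<beta>\<bar> * 1" by simp
      also have "\<dots> \<le> \<bar>ln \<beta>\<bar> * ln (1 / \<epsilon>)"
        using elim by (intro mult_left_mono) auto
      finally show "ln \<beta> \<le> \<bar>ln \<beta>\<bar> * ln (1 / \<epsilon>)" .
    qed (use elim g in auto)
    also have "\<dots> = C * ln (1 / \<epsilon>)"
      by (simp add: C_def algebra_simps add_divide_distrib)
    finally show ?case using elim by simp
  qed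
qed

text \<open>
  Every outer iteration performed has \<open>\<mu>\<^sup>k \<ge> \<gamma> \<epsilon>\<close>, so its length is at most a constant times
  \<open>1 / \<epsilon>\<close>.
\<close>

lemma T_ADMM_bigo:
  fixes A :: "real^'n^'m"
  assumes rank: "rank A = CARD('m)" and \<beta>: "\<beta> > 0" and \<gamma>: "0 < \<gamma>" "\<gamma> < 1"
  shows "(\<lambda>\<epsilon>. real (T_ADMM A b c \<beta> \<gamma> \<epsilon>)) \<in> O[at_right 0](\<lambda>\<epsilon>. 1 / \<epsilon> * ln (1 / \<epsilon>))"
proof -
  obtain K where K: "\<And>k. real (N_inner A b c \<beta> \<gamma> k) * mu \<beta> \<gamma> k \<le> K"
    using N_inner_bounded[OF assms] by blast
  have "(\<lambda>\<epsilon>. real (T_ADMM A b c \<beta> \<gamma> \<epsilon>)) \<in> O[at_right 0](\<lambda>\<epsilon>. 1 / \<epsilon> * real (T_IPM \<beta> \<gamma> \<epsilon>))"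
  proof (rule bigoI)
    have "\<forall>\<^sub>F \<epsilon> in at_right 0. \<epsilon> < \<beta>" "\<forall>\<^sub>F \<epsilon> in at_right 0. (0::real) < \<epsilon>"
      using \<beta> eventually_at_right_less[of "0::real"] by (auto simp: eventually_at_right_field)
    then show "\<forall>\<^sub>F \<epsilon> in at_right 0. norm (real (T_ADMM A b c \<beta> \<gamma> \<epsilon>))
        \<le> K / \<gamma> * norm (1 / \<epsilon> * real (T_IPM \<beta> \<gamma> \<epsilon>))"
    proof eventually_elim
      case (elim \<epsilon>)
      have "real (N_inner A b c \<beta> \<gamma> k) \<le> K / (\<gamma> * \<epsilon>)" if k: "k < T_IPM \<beta> \<gamma> \<epsilon>" for k
      proof -
        let ?K = "LEAST k. mu \<beta> \<gamma> k < \<epsilon>"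
        have "\<gamma> * \<epsilon> \<le> mu \<beta> \<gamma> ?K"
          using mu_stopping_index(2)[OF \<beta> \<gamma>, of \<epsilon>] elim by simp
        also have "\<dots> \<le> mu \<beta> \<gamma> k"
          using k \<beta> \<gamma> by (simp add: mu_eq T_IPM_def power_decreasing)
        finally have "real (N_inner A b c \<beta> \<gamma> k) * (\<gamma> * \<epsilon>) \<le> K"
          using K[of k] mult_left_mono[of "\<gamma> * \<epsilon>" "mu \<beta> \<gamma> k" "real (N_inner A b c \<beta> \<gamma> k)"]
          by linarith
        then show ?thesis using elim \<gamma> by (simp add: pos_le_divide_eq)
      qed
      then have "real (T_ADMM A b c \<beta> \<gamma> \<epsilon>) \<le> (\<Sum>k<T_IPM \<beta> \<gamma> \<epsilon>. K / (\<gamma> * \<epsilon>))"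
        unfolding T_ADMM_def of_nat_sum by (intro sum_mono) simp
      then show ?case
        using elim by (simp add: mult.commute)
    qed
  qed
  also have "(\<lambda>\<epsilon>. 1 / \<epsilon> * real (T_IPM \<beta> \<gamma> \<epsilon>)) \<in> O[at_right 0](\<lambda>\<epsilon>. 1 / \<epsilon> * ln (1 / \<epsilon>))"
    using T_IPM_bigo[OF \<beta> \<gamma>] by (intro landau_o.big.mult) auto
  finally show ?thesis .
qed

section \<open>Eigenvalues of symmetric matrices\<close>

lemma symmetric_matrix_inner:
  fixes M :: "real^'a^'a"
  assumes "transpose M = M"
  shows "(M *v x) \<bullet> y = x \<bullet> (M *v y)"
  using assms by (metis dot_lmul_matrix transpose_matrix_vector)

text \<open>
  Eigenvectors for distinct eigenvalues are orthogonal, hence linearly independent.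
\<close>

lemma finite_eigenvalues_symmetric:
  fixes M :: "real^'a^'a"
  assumes sym: "transpose M = M"
  shows "finite (eigenvalues M)"
proof -
  have "\<forall>l\<in>eigenvalues M. \<exists>w. w \<noteq> 0 \<and> M *v w = l *\<^sub>R w"
    by (simp add: eigenvalues_def)
  then obtain w where w: "\<And>l. l \<in> eigenvalues M \<Longrightarrow> w l \<noteq> 0 \<and> M *v w l = l *\<^sub>R w l"
    by (meson bchoice)
  have orth: "w l \<bullet> w l' = 0" if "l \<in> eigenvalues M" "l' \<in> eigenvalues M" "l \<noteq> l'" for l l'
  proof -
    have "l * (w l \<bullet> w l') = l' * (w l \<bullet> w l')"
      using symmetric_matrix_inner[OF sym, of "w l" "w l'"] w[OF that(1)] w[OF that(2)] by simp
    with that(3) show ?thesis by simp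
  qed
  have "inj_on w (eigenvalues M)"
    using orth w by (metis inj_onI inner_eq_zero_iff)
  moreover have "independent (w ` eigenvalues M)"
    by (rule pairwise_orthogonal_independent)
      (use orth w in \<open>auto simp: pairwise_def orthogonal_def\<close>)
  then have "finite (w ` eigenvalues M)"
    by (rule finiteI_independent)
  ultimately show ?thesis using finite_imageD by blast
qed

text \<open>
  The maximum \<open>l\<close> of the Rayleigh quotient is an eigenvalue. At a maximiser \<open>w\<close> put
  \<open>r = M w - l w\<close>; moving from \<open>w\<close> in the direction \<open>r\<close> changes \<open>x \<bullet> M x - l (x \<bullet> x)\<close> to first order by
  \<open>2 t (r \<bullet> r)\<close>, which must not become positive.
\<close>

lemma eigenvalue_exists_symmetric:
  fixes M :: "real^'a^'a"
  assumes sym: "transpose M = M"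
  shows "eigenvalues M \<noteq> {}"
proof -
  have "continuous_on (sphere 0 1) (\<lambda>x. x \<bullet> (M *v x))"
    by (intro continuous_intros)
  moreover have "sphere (0::real^'a) 1 \<noteq> {}" by simp
  ultimately obtain w where w: "norm w = 1"
    "\<And>x. norm x = 1 \<Longrightarrow> x \<bullet> (M *v x) \<le> w \<bullet> (M *v w)"
    using continuous_attains_sup[of "sphere 0 1" "\<lambda>x. x \<bullet> (M *v x)"] by (auto simp: compact_sphere)
  define l where "l = w \<bullet> (M *v w)"
  define r where "r = M *v w - l *\<^sub>R w"
  have rayleigh: "x \<bullet> (M *v x) \<le> l * (x \<bullet> x)" for x
  proof (cases "x = 0")
    case False
    let ?y = "(1 / norm x) *\<^sub>R x"
    have "?y \<bullet> (M *v ?y) \<le> l"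
      unfolding l_def using False by (intro w(2)) simp
    then have "(x \<bullet> (M *v x)) / (norm x * norm x) \<le> l"
      by (simp add: matrix_vector_mult_scaleR)
    then show ?thesis
      using False by (simp add: pos_divide_le_eq dot_square_norm power2_eq_square)
  qed simp
  have ww: "w \<bullet> w = 1" using w(1) by (simp add: dot_square_norm)
  define B where "B = l * (r \<bullet> r) - r \<bullet> (M *v r)"
  have quad: "2 * t * (r \<bullet> r) \<le> t\<^sup>2 * B" for t
  proof -
    have "(w + t *\<^sub>R r) \<bullet> (M *v (w + t *\<^sub>R r)) \<le> l * ((w + t *\<^sub>R r) \<bullet> (w + t *\<^sub>R r))"
      by (rule rayleigh)
    moreover have "w \<bullet> (M *v r) = r \<bullet> (M *v w)"
      using symmetric_matrix_inner[OF sym, of w r] by (simp add: inner_commute)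
    moreover have "r \<bullet> (M *v w) = r \<bullet> r + l * (r \<bullet> w)"
      by (simp add: r_def algebra_simps)
    moreover have "w \<bullet> (M *v w) = l" by (simp add: l_def)
    ultimately show ?thesis
      by (simp add: B_def ww matrix_vector_right_distrib matrix_vector_mult_scaleR inner_commute
          power2_eq_square algebra_simps)
  qed
  have "r \<bullet> r \<le> 0"
  proof (rule ccontr)
    assume "\<not> r \<bullet> r \<le> 0"
    then have rr: "r \<bullet> r > 0" by (simp only: not_le)
    show False
    proof (cases "B > 0")
      case True
      (* This step length turns the quadratic inequality into one without a free parameter. *)
      have "2 * ((r \<bullet> r) / B) * (r \<bullet> r) \<le> ((r \<bullet> r) / B)\<^sup>2 * B" by (rule quad)
      then have "(r \<bullet> r)\<^sup>2 / B \<le> 0" using True by (simp add: power2_eq_square field_simps)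
      then show False using rr True by (simp add: divide_le_0_iff)
    next
      case False
      then show False using quad[of 1] rr by simp
    qed
  qed
  then have "r = 0" by (metis inner_gt_zero_iff not_le)
  then have "M *v w = l *\<^sub>R w" by (simp add: r_def)
  moreover have "w \<noteq> 0" using w(1) by auto
  ultimately show ?thesis by (auto simp: eigenvalues_def)
qed

section \<open>Positivity of the constant factor\<close>

text \<open>
  If \<open>w\<close> is an eigenvector of \<open>A\<close> times its transpose, then the transpose of \<open>A\<close> maps it to an
  eigenvector of the product in the other order, with the same eigenvalue, which is positive by
  full row rank. So the least eigenvalue of the first product is positive, and it is a lower bound
  for the largest eigenvalue of the second.
\<close>

lemma kappa_A_pos:
  fixes A :: "real^'n^'m"
  assumes rank: "rank A = CARD('m)"
  shows "kappa_A A > 0"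
proof -
  let ?G = "A ** transpose A" and ?H = "transpose A ** A"
  have sym: "transpose ?G = ?G" "transpose ?H = ?H"
    by (simp_all add: matrix_transpose_mul)
  have inj: "inj ((*v) (transpose A))"
    using rank by (simp only: full_rank_injective[symmetric] rank_transpose)
  have eig: "l > 0 \<and> l \<in> eigenvalues ?H" if l: "l \<in> eigenvalues ?G" for l
  proof -
    obtain w where w: "w \<noteq> 0" "?G *v w = l *\<^sub>R w"
      using l by (auto simp: eigenvalues_def)
    let ?x = "transpose A *v w"
    have x: "?x \<noteq> 0"
      using inj w(1) injD[of "(*v) (transpose A)" w 0] by auto
    have Ax: "A *v ?x = l *\<^sub>R w"
      using w(2) by (simp only: matrix_vector_mul_assoc)
    have "?x \<bullet> ?x = w \<bullet> (A *v ?x)"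
      by (simp add: dot_lmul_matrix)
    also have "\<dots> = l * (w \<bullet> w)" by (simp only: Ax inner_scaleR_right)
    finally have "l * (w \<bullet> w) > 0" using x by (metis inner_gt_zero_iff)
    moreover have "w \<bullet> w > 0" using w(1) by (simp only: inner_gt_zero_iff not_False_eq_True)
    ultimately have "l > 0" by (rule zero_less_mult_pos2)
    moreover have "?H *v ?x = l *\<^sub>R ?x"
      by (simp only: matrix_vector_mul_assoc[symmetric] Ax matrix_vector_mult_scaleR)
    ultimately show ?thesis using x unfolding eigenvalues_def by blast
  qed
  have fin: "finite (eigenvalues ?G)" "finite (eigenvalues ?H)"
    using sym by (auto intro: finite_eigenvalues_symmetric)
  have ne: "eigenvalues ?G \<noteq> {}"
    using sym by (intro eigenvalue_exists_symmetric)
  have min: "lambda_min ?G \<in> eigenvalues ?G"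
    unfolding lambda_min_def using fin ne by (intro Min_in)
  then have "lambda_min ?G > 0" "lambda_min ?G \<le> lambda_max ?H"
    unfolding lambda_max_def using eig fin by (auto intro: Max_ge)
  then show ?thesis by (simp add: kappa_A_def)
qed

lemma spectral_norm_Q_mat_pos: "spectral_norm (Q_mat A b c) > 0"
proof -
  have "snd initial_state $ BTau \<noteq> 0"
    by (simp add: initial_state_def)
  then have "Q_mat A b c *v fst initial_state \<noteq> 0"
    unfolding Q_mat_initial by (metis zero_index)
  then show ?thesis
    unfolding spectral_norm_def
    by (subst onorm_pos_lt) (auto intro: matrix_vector_mul_bounded_linear)
qed

section \<open>The complexity bound\<close>

theorem theorem3p7:
  fixes A :: "real^'n^'m" and b :: "real^'m" and c :: "real^'n" and \<beta> \<gamma> :: real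
  assumes "CARD('m) \<le> CARD('n)"
    and "rank A = CARD('m)"
    and "\<beta> > 0"
    and "0 < \<gamma>" and "\<gamma> < 1"
  shows "(\<forall>k. \<exists>i. inner_stop A b c (mu \<beta> \<gamma> k) (iterate A b c \<beta> \<gamma> k i))
    \<and> (\<lambda>\<epsilon>. real (T_IPM \<beta> \<gamma> \<epsilon>)) \<in> O[at_right 0](\<lambda>\<epsilon>. ln (1 / \<epsilon>))
    \<and> (\<lambda>\<epsilon>. real (T_ADMM A b c \<beta> \<gamma> \<epsilon>))
        \<in> O[at_right 0](\<lambda>\<epsilon>. (kappa_A A)\<^sup>2 * (spectral_norm (Q_mat A b c))\<^sup>2 / \<epsilon> * ln (1 / \<epsilon>))"
proof (intro conjI)
  show "\<forall>k. \<exists>i. inner_stop A b c (mu \<beta> \<gamma> k) (iterate A b c \<beta> \<gamma> k i)"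
    using N_inner_bounded[OF assms(2-)] by metis
  show "(\<lambda>\<epsilon>. real (T_IPM \<beta> \<gamma> \<epsilon>)) \<in> O[at_right 0](\<lambda>\<epsilon>. ln (1 / \<epsilon>))"
    using T_IPM_bigo assms(3-) .
  let ?c = "(kappa_A A)\<^sup>2 * (spectral_norm (Q_mat A b c))\<^sup>2"
  have "?c \<noteq> 0"
    using kappa_A_pos[OF assms(2)] spectral_norm_Q_mat_pos[of A b c] by simp
  then have "(\<lambda>\<epsilon>. real (T_ADMM A b c \<beta> \<gamma> \<epsilon>)) \<in> O[at_right 0](\<lambda>\<epsilon>. ?c * (1 / \<epsilon> * ln (1 / \<epsilon>)))"
    using T_ADMM_bigo[OF assms(2-), of b c] by (subst landau_o.big.cmult)
  then show "(\<lambda>\<epsilon>. real (T_ADMM A b c \<beta> \<gamma> \<epsilon>))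
        \<in> O[at_right 0](\<lambda>\<epsilon>. ?c / \<epsilon> * ln (1 / \<epsilon>))"
    by simp
qed

end
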